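(* Consider the system $F_\alpha(x,u^{(s)},\widetilde u^{(s)})=0$, $\alpha=1,\ldots,m$. Suppose it admits the Lie--Bäcklund operator $$X=\sum_{i=1}^n\xi^i\frac{\partial}{\partial x^i}+\sum_{\beta=1}^m\eta_\beta\frac{\partial}{\partial u^\beta}+\sum_{\widetilde\beta=1}^{\widetilde m}\widetilde\eta_{\widetilde\beta}\frac{\partial}{\partial\widetilde u^{\widetilde\beta}},$$ i.e. $\xi^i,\eta_\beta,\widetilde\eta_{\widetilde\beta}$ are any differential functions of $x$, $u$, $\widetilde u$ and derivatives of $u,\widetilde u$, and $$\mathrm{Pr}\,X(F_\nu)=\sum_{\mu=1}^m\mathcal D_{\nu\mu}(F_\mu),\qquad \nu=1,\ldots,m,$$ for some (finite-order) differential operators $$\mathcal D_{\nu\mu}=\lambda^0_{\nu\mu}+\sum_{i_1=1}^n\lambda^{i_1}_{\nu\mu}D_{x^{i_1}}+\sum_{i_1,i_2=1}^n\lambda^{i_1i_2}_{\nu\mu}D_{x^{i_1}}D_{x^{i_2}}+\sum_{i_1,i_2,i_3=1}^n\lambda^{i_1i_2i_3}_{\nu\mu}D_{x^{i_1}}D_{x^{i_2}}D_{x^{i_3}}+\cdots$$ whose coefficients are differential functions. Then the adjoint equations $F^\star_\alpha=0$, $\widetilde F^\star_{\widetilde\alpha}=0$, considered together with the system $F_\alpha=0$, admit the Lie--Bäcklund operator $$Y=X+\sum_{\beta=1}^m\eta^\star_\beta\frac{\partial}{\partial v^\beta}+\sum_{\widetilde\beta=1}^{\widetilde m}\widetilde\eta^\star_{\widetilde\beta}\frac{\partial}{\partial\widetilde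 v^{\widetilde\beta}},$$ where $\eta^\star_\beta,\widetilde\eta^\star_{\widetilde\beta}$ are differential functions satisfying, for $\beta=1,\ldots,m$, $$\eta^\star_\beta+\sum_{\widetilde\beta=1}^{\widetilde m}\widetilde\eta^\star_{\widetilde\beta}=-\Big\{w^\beta\sum_{i_1=1}^nD_{x^{i_1}}(\xi^{i_1})+\sum_{\mu=1}^m\Big[w^\mu\lambda^0_{\mu\beta}-\sum_{i_1=1}^nD_{x^{i_1}}\big(w^\mu\lambda^{i_1}_{\mu\beta}\big)+\sum_{i_1,i_2=1}^nD_{x^{i_1}}D_{x^{i_2}}\big(w^\mu\lambda^{i_1i_2}_{\mu\beta}\big)-\sum_{i_1,i_2,i_3=1}^nD_{x^{i_1}}D_{x^{i_2}}D_{x^{i_3}}\big(w^\mu\lambda^{i_1i_2i_3}_{\mu\beta}\big)+\cdots\Big]\Big\}$$ with $w^\alpha=v^\alpha+\sum_{\widetilde\beta=1}^{\widetilde m}\widetilde v^{\widetilde\beta}$.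
   Context: Independent variables: $x=(x^1,\ldots,x^n)$. Dependent variables: $u=(u^1,\ldots,u^m)$ and $\widetilde u=(\widetilde u^1,\ldots,\widetilde u^{\widetilde m})$, functions of $x$. The number of equations $m$ is less than or equal to the number $m+\widetilde m$ of dependent variables ($\widetilde m\ge 0$; empty sums are $0$). $u^{(s)}$ denotes the tuple of the $u^j$ and all their partial derivatives up to order $s$; similarly $\widetilde u^{(s)}$. A differential function is a smooth function of $x$ and finitely many derivatives of the dependent variables; the $F_\alpha$ are differential functions. $D_{x^i}$ is the total derivative with respect to $x^i$. For a dependent variable $z$, the variational derivative is $\frac{\delta}{\delta z}=\sum_J(-1)^{|J|}D_J\frac{\partial}{\partial z_J}$, where $J=(j_1,\ldots,j_n)$ runs over multi-indices, $D_J=D_{x^1}^{j_1}\cdots D_{x^n}^{j_n}$ and $z_J=\partial^{|J|}z/\partial (x^1)^{j_1}\cdots\partial(x^n)^{j_n}$. Adjoint equations: introduce new dependent variables $v=(v^1,\ldots,v^m)$ and $\widetilde v=(\widetilde v^1,\ldots,\widetilde v^{\widetilde m})$, functions of $x$, and set $$F^\star_\alpha=\frac{\delta L}{\delta u^\alpha},\qquad \widetilde F^\star_{\widetilde\alpha}=\frac{\delta L}{\delta\widetilde u^{\widetilde\alpha}},\qquad L=\sum_{\beta=1}^m v^\beta F_\beta+\Big(\sum_{\widetilde\beta=1}^{\widetilde m}\widetilde v^{\widetilde\beta}\Big)\Big(\sum_{\nu=1}^m F_\nu\Big).$$ The adjoint equations are $F^\star_\alpha=0$ for $\alpha=1,\ldots,m$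 and $\widetilde F^\star_{\widetilde\alpha}=0$ for $\widetilde\alpha=1,\ldots,\widetilde m$. Prolongation: for an operator $Z=\sum_i\xi^i\partial_{x^i}+\sum_z\zeta^z\partial_z$ ($z$ running over the dependent variables, coefficients being differential functions), $\mathrm{Pr}\,Z=\sum_i\xi^iD_{x^i}+\sum_z\sum_J D_J(W^z)\frac{\partial}{\partial z_J}$ with $W^z=\zeta^z-\sum_i\xi^i z_{x^i}$. A system of equations $E_1=\cdots=E_r=0$ admits the Lie--Bäcklund operator $Z$ if each $\mathrm{Pr}\,Z(E_k)$ vanishes at all points of jet space where all $E_1,\ldots,E_r$ and all their total derivatives vanish. *)

theory Defs
  imports "HOL-Analysis.Analysis" "HOL-Library.Groups_Big_Fun"
begin

text \<open>
  The independent variables are \<open>x\<^sup>i\<close> for \<open>i \<in> {1..n}\<close>. The dependent variables are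
  \<open>u\<^sup>\<beta>\<close> = \<open>U \<beta>\<close> and \<open>v\<^sup>\<beta>\<close> = \<open>V \<beta>\<close> for \<open>\<beta> \<in> {1..m}\<close>, and their counterparts with a
  tilde, \<open>Ut \<beta>\<close> and \<open>Vt \<beta>\<close> for \<open>\<beta> \<in> {1..mt}\<close>.
\<close>

datatype depvar = U nat | Ut nat | V nat | Vt nat

definition u_vars :: "nat \<Rightarrow> nat \<Rightarrow> depvar set" where
  "u_vars m mt = U ` {1..m} \<union> Ut ` {1..mt}"

definition uv_vars :: "nat \<Rightarrow> nat \<Rightarrow> depvar set" where
  "uv_vars m mt = u_vars m mt \<union> V ` {1..m} \<union> Vt ` {1..mt}"

text \<open>
  A multi-index \<open>(j\<^sub>1, \<dots>, j\<^sub>n)\<close> is a function on \<open>nat\<close> that vanishes outside \<open>{1..n}\<close>.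
  \<open>Indep i\<close> is the coordinate \<open>x\<^sup>i\<close> and \<open>Jet z J\<close> is the coordinate \<open>z\<^sub>J\<close>.
  Points of jet space assign values to all these symbols, so one type serves for all values of
  \<open>n\<close>, \<open>m\<close>, \<open>mt\<close>; coordinates outside \<open>coords\<close> are irrelevant because differential functions do
  not depend on them.
\<close>

type_synonym multi_index = "nat \<Rightarrow> nat"

datatype coord = Indep nat | Jet depvar multi_index

type_synonym jet = "coord \<Rightarrow> real"

definition coords :: "nat \<Rightarrow> depvar set \<Rightarrow> coord set" where
  "coords n Z = Indep ` {1..n} \<union> {Jet z J | z J. z \<in> Z \<and> (\<forall>i. i \<notin> {1..n} \<longrightarrow> J i = 0)}"

definition zero_index :: multi_index where
  "zero_index = (\<lambda>_. 0)"

definition incr_index :: "nat \<Rightarrow> multi_index \<Rightarrow> multi_index" where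
  "incr_index i J = J(i := Suc (J i))"

definition jet_partial :: "coord \<Rightarrow> (jet \<Rightarrow> real) \<Rightarrow> jet \<Rightarrow> real" where
  "jet_partial c f p = deriv (\<lambda>t. f (p(c := t))) (p c)"

text \<open>
  Smoothness means that all iterated partial derivatives exist and are continuous. Continuity is
  with respect to the product topology, which for a function of finitely many coordinates is
  continuity in these coordinates.
\<close>

definition jet_smooth :: "(jet \<Rightarrow> real) \<Rightarrow> bool" where
  "jet_smooth f \<longleftrightarrow> (\<forall>cs. continuous_on UNIV (foldr jet_partial cs f) \<and>
     (\<forall>c p. (\<lambda>t. foldr jet_partial cs f (p(c := t))) field_differentiable at (p c)))"

definition diff_function :: "nat \<Rightarrow> depvar set \<Rightarrow> (jet \<Rightarrow> real) \<Rightarrow> bool" where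
  "diff_function n Z f \<longleftrightarrow> jet_smooth f \<and>
     (\<exists>C. finite C \<and> C \<subseteq> coords n Z \<and> (\<forall>p q. (\<forall>c\<in>C. p c = q c) \<longrightarrow> f p = f q))"

text \<open>
  For a differential function only finitely many terms of the following sums
  (\<^const>\<open>Sum_any\<close>) are nonzero.
\<close>

definition total_deriv :: "nat \<Rightarrow> (jet \<Rightarrow> real) \<Rightarrow> jet \<Rightarrow> real" where
  "total_deriv i f p = jet_partial (Indep i) f p +
     Sum_any (\<lambda>(z, J). p (Jet z (incr_index i J)) * jet_partial (Jet z J) f p)"

definition total_deriv_index :: "nat \<Rightarrow> multi_index \<Rightarrow> (jet \<Rightarrow> real) \<Rightarrow> jet \<Rightarrow> real" where
  "total_deriv_index n J = foldr (\<lambda>i. total_deriv i ^^ J i) [1..<Suc n]"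

definition total_deriv_list :: "nat list \<Rightarrow> (jet \<Rightarrow> real) \<Rightarrow> jet \<Rightarrow> real" where
  "total_deriv_list is = foldr total_deriv is"

definition variational_deriv :: "nat \<Rightarrow> depvar \<Rightarrow> (jet \<Rightarrow> real) \<Rightarrow> jet \<Rightarrow> real" where
  "variational_deriv n z f p =
     Sum_any (\<lambda>J. (-1) ^ (\<Sum>i=1..n. J i) * total_deriv_index n J (jet_partial (Jet z J) f) p)"

text \<open>
  An operator \<open>\<Sum>\<^sub>i \<xi>\<^sup>i \<partial>/\<partial>x\<^sup>i + \<Sum>\<^sub>z \<zeta>\<^sup>z \<partial>/\<partial>z\<close>, with \<open>z\<close> ranging over \<open>Z\<close>, is given by its
  coefficients \<open>\<xi>\<close> and \<open>\<zeta>\<close>.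
\<close>

definition characteristic ::
  "nat \<Rightarrow> (nat \<Rightarrow> jet \<Rightarrow> real) \<Rightarrow> (depvar \<Rightarrow> jet \<Rightarrow> real) \<Rightarrow> depvar \<Rightarrow> jet \<Rightarrow> real" where
  "characteristic n \<xi> \<zeta> z p = \<zeta> z p - (\<Sum>i=1..n. \<xi> i p * p (Jet z (incr_index i zero_index)))"

definition prolongation ::
  "nat \<Rightarrow> depvar set \<Rightarrow> (nat \<Rightarrow> jet \<Rightarrow> real) \<Rightarrow> (depvar \<Rightarrow> jet \<Rightarrow> real) \<Rightarrow>
   (jet \<Rightarrow> real) \<Rightarrow> jet \<Rightarrow> real" where
  "prolongation n Z \<xi> \<zeta> f p = (\<Sum>i=1..n. \<xi> i p * total_deriv i f p) +
     (\<Sum>z\<in>Z. Sum_any (\<lambda>J. total_deriv_index n J (characteristic n \<xi> \<zeta> z) p * jet_partial (Jet z J) f p))"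

definition admits ::
  "nat \<Rightarrow> depvar set \<Rightarrow> (jet \<Rightarrow> real) set \<Rightarrow>
   (nat \<Rightarrow> jet \<Rightarrow> real) \<Rightarrow> (depvar \<Rightarrow> jet \<Rightarrow> real) \<Rightarrow> bool" where
  "admits n Z S \<xi> \<zeta> \<longleftrightarrow>
     (\<forall>E\<in>S. \<forall>p. (\<forall>G\<in>S. \<forall>J. total_deriv_index n J G p = 0) \<longrightarrow> prolongation n Z \<xi> \<zeta> E p = 0)"

text \<open>
  A differential operator of order at most \<open>r\<close> has one coefficient \<open>c [i\<^sub>1, \<dots>, i\<^sub>k]\<close> for each
  tuple of indices of length \<open>k \<le> r\<close>; \<open>c []\<close> is the coefficient of order \<open>0\<close>.
\<close>

definition index_lists :: "nat \<Rightarrow> nat \<Rightarrow> nat list set" where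
  "index_lists n k = {is. set is \<subseteq> {1..n} \<and> length is = k}"

definition diff_operator ::
  "nat \<Rightarrow> nat \<Rightarrow> (nat list \<Rightarrow> jet \<Rightarrow> real) \<Rightarrow> (jet \<Rightarrow> real) \<Rightarrow> jet \<Rightarrow> real" where
  "diff_operator n r c f p =
     (\<Sum>k\<le>r. \<Sum>is\<in>index_lists n k. c is p * total_deriv_list is f p)"

definition adjoint_operator ::
  "nat \<Rightarrow> nat \<Rightarrow> (nat list \<Rightarrow> jet \<Rightarrow> real) \<Rightarrow> (jet \<Rightarrow> real) \<Rightarrow> jet \<Rightarrow> real" where
  "adjoint_operator n r c f p =
     (\<Sum>k\<le>r. (-1) ^ k * (\<Sum>is\<in>index_lists n k. total_deriv_list is (\<lambda>q. f q * c is q) p))"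

definition adjoint_lagrangian :: "nat \<Rightarrow> nat \<Rightarrow> (nat \<Rightarrow> jet \<Rightarrow> real) \<Rightarrow> jet \<Rightarrow> real" where
  "adjoint_lagrangian m mt F p =
     (\<Sum>\<beta>=1..m. p (Jet (V \<beta>) zero_index) * F \<beta> p) +
     (\<Sum>\<beta>=1..mt. p (Jet (Vt \<beta>) zero_index)) * (\<Sum>\<nu>=1..m. F \<nu> p)"

definition adjoint_F :: "nat \<Rightarrow> nat \<Rightarrow> nat \<Rightarrow> (nat \<Rightarrow> jet \<Rightarrow> real) \<Rightarrow> nat \<Rightarrow> jet \<Rightarrow> real" where
  "adjoint_F n m mt F \<alpha> = variational_deriv n (U \<alpha>) (adjoint_lagrangian m mt F)"

definition adjoint_Ft :: "nat \<Rightarrow> nat \<Rightarrow> nat \<Rightarrow> (nat \<Rightarrow> jet \<Rightarrow> real) \<Rightarrow> nat \<Rightarrow> jet \<Rightarrow> real" where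
  "adjoint_Ft n m mt F \<alpha> = variational_deriv n (Ut \<alpha>) (adjoint_lagrangian m mt F)"

definition w_fun :: "nat \<Rightarrow> nat \<Rightarrow> jet \<Rightarrow> real" where
  "w_fun mt \<alpha> p = p (Jet (V \<alpha>) zero_index) + (\<Sum>\<beta>=1..mt. p (Jet (Vt \<beta>) zero_index))"

end

theory Submission
  imports Defs
begin

text \<open>
  Let \<open>L = \<Sum>\<^sub>\<beta> w\<^sup>\<beta> F\<^sub>\<beta>\<close> be the Lagrangian, \<open>E\<^sub>z\<close> the variational derivatives, \<open>W\<close> the characteristic
  of \<open>Y\<close> and \<open>pr\<^sub>W\<close> its evolutionary part, which commutes with all total derivatives. The condition
  on the coefficients of \<open>Y\<close> turns \<open>Pr Y(L) + L \<Sum>\<^sub>i D\<^sub>i \<xi>\<^sup>i\<close>, which is \<open>pr\<^sub>W L + \<Sum>\<^sub>i D\<^sub>i(\<xi>\<^sup>i L)\<close>,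
  into a sum of terms \<open>w \<D>(F) - \<D>\<^sup>*(w) F\<close>. Hence it is annihilated by every \<open>E\<^sub>z\<close>, and so is
  \<open>pr\<^sub>W L\<close>. With \<open>A\<^sub>z(f, g) = \<Sum>\<^sub>K (-D)\<^sub>K(g \<partial>f/\<partial>z\<^sub>K)\<close> one has \<open>A\<^sub>z(D\<^sub>i f, g) = - A\<^sub>z(f, D\<^sub>i g)\<close>, from
  which \<open>E\<^sub>z(pr\<^sub>W L) = pr\<^sub>W(E\<^sub>z L) + \<Sum>\<^sub>y A\<^sub>z(W\<^sup>y, E\<^sub>y L)\<close>. Each \<open>E\<^sub>y L\<close> lies in the differential ideal of
  the adjoint equations and the equations \<open>F\<^sub>\<alpha> = 0\<close>, hence so does \<open>pr\<^sub>W(E\<^sub>z L)\<close>.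
\<close>

section \<open>Smooth functions on jet space\<close>

lemma jet_partial_eqI:
  assumes "((\<lambda>t. f (p(c := t))) has_real_derivative D) (at (p c))"
  shows "jet_partial c f p = D"
  using assms unfolding jet_partial_def by (rule DERIV_imp_deriv)

text \<open>Iterated partial derivatives never leave a class closed under
  \<open>jet_partial\<close>, so regularity has to be checked only once for the members of the
  class.\<close>

lemma jet_smooth_coinduct [consumes 1, case_names continuous differentiable partial]:
  assumes "P f"
    and "\<And>g. P g \<Longrightarrow> continuous_on UNIV g"
    and "\<And>g c p. P g \<Longrightarrow> (\<lambda>t. g (p(c := t))) field_differentiable at (p c)"
    and "\<And>g c. P g \<Longrightarrow> P (jet_partial c g)"
  shows "jet_smooth f"
proof -
  have "P (foldr jet_partial cs f)" for cs
    by (induction cs) (simp_all add: assms)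
  then show ?thesis
    unfolding jet_smooth_def using assms(2,3) by blast
qed

lemma jet_smooth_continuous: "jet_smooth f \<Longrightarrow> continuous_on UNIV f"
  unfolding jet_smooth_def by (metis foldr_Nil id_apply)

lemma jet_smooth_differentiable:
  "jet_smooth f \<Longrightarrow> (\<lambda>t. f (p(c := t))) field_differentiable at (p c)"
  unfolding jet_smooth_def by (metis foldr_Nil id_apply)

lemma jet_smooth_partial:
  assumes "jet_smooth f"
  shows "jet_smooth (jet_partial c f)"
proof -
  have "foldr jet_partial cs (jet_partial c f) = foldr jet_partial (cs @ [c]) f" for cs
    by simp
  then show ?thesis
    using assms unfolding jet_smooth_def by metis
qed

lemma jet_smooth_has_derivative:
  assumes "jet_smooth f"
  shows "((\<lambda>t. f (p(c := t))) has_real_derivative jet_partial c f (p(c := s))) (at s)"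
  using jet_smooth_differentiable[OF assms, of "p(c := s)" c]
  by (simp add: jet_partial_def DERIV_deriv_iff_field_differentiable)

lemma jet_smooth_has_derivative':
  assumes "jet_smooth f"
  shows "((\<lambda>t. f (p(c := t))) has_real_derivative jet_partial c f p) (at (p c))"
  using jet_smooth_has_derivative[OF assms, of p c "p c"] by simp

section \<open>Sum and product rules, closure of smoothness under ring operations\<close>

lemma jet_partial_add:
  assumes "jet_smooth f" "jet_smooth g"
  shows "jet_partial c (\<lambda>p. f p + g p) = (\<lambda>p. jet_partial c f p + jet_partial c g p)"
  by (intro ext jet_partial_eqI DERIV_add jet_smooth_has_derivative' assms)

lemma jet_partial_mult:
  assumes "jet_smooth f" "jet_smooth g"
  shows "jet_partial c (\<lambda>p. f p * g p) = (\<lambda>p. jet_partial c f p * g p + f p * jet_partial c g p)"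
proof (intro ext jet_partial_eqI)
  fix p
  have "((\<lambda>t. f (p(c := t)) * g (p(c := t))) has_real_derivative
     (jet_partial c f p * g (p(c := p c)) + jet_partial c g p * f (p(c := p c)))) (at (p c))"
    by (intro DERIV_mult jet_smooth_has_derivative' assms)
  then show "((\<lambda>t. f (p(c := t)) * g (p(c := t))) has_real_derivative
     (jet_partial c f p * g p + f p * jet_partial c g p)) (at (p c))"
    by (simp add: mult.commute)
qed

lemma jet_partial_const [simp]: "jet_partial c (\<lambda>p. k) = (\<lambda>p. 0)"
  by (intro ext jet_partial_eqI) simp

lemma jet_partial_coord: "jet_partial c (\<lambda>p. p d) = (\<lambda>p. if c = d then 1 else 0)"
  by (intro ext jet_partial_eqI) auto

lemma jet_smooth_const: "jet_smooth (\<lambda>p. k)"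
proof -
  have "\<exists>k'. (\<lambda>p::jet. k) = (\<lambda>p. k')" by blast
  then show ?thesis
    by (rule jet_smooth_coinduct[where P = "\<lambda>f. \<exists>k. f = (\<lambda>p. k)"]) auto
qed

lemma jet_smooth_coord: "jet_smooth (\<lambda>p. p d)"
proof (rule jet_smooth_coinduct[where P = "\<lambda>f. f = (\<lambda>p. p d) \<or> jet_smooth f"])
  fix g :: "jet \<Rightarrow> real" assume *: "g = (\<lambda>p. p d) \<or> jet_smooth g"
  show "continuous_on UNIV g"
    using * jet_smooth_continuous continuous_on_product_coordinates by auto
  show "(\<lambda>t. g (p(c := t))) field_differentiable at (p c)" for c p
    using * jet_smooth_differentiable by (cases "c = d") auto
  show "jet_partial c g = (\<lambda>p. p d) \<or> jet_smooth (jet_partial c g)" for c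
    using * jet_smooth_partial by (auto simp: jet_partial_coord jet_smooth_const)
qed simp

text \<open>
  Closure under products cannot be proved for a single function by coinduction, since the partial
  derivatives of a product are sums of products; the hull is closed under partial derivatives.
\<close>

inductive smooth_hull :: "(jet \<Rightarrow> real) \<Rightarrow> bool" where
  base: "jet_smooth f \<Longrightarrow> smooth_hull f"
| add: "smooth_hull f \<Longrightarrow> smooth_hull g \<Longrightarrow> smooth_hull (\<lambda>p. f p + g p)"
| mult: "smooth_hull f \<Longrightarrow> smooth_hull g \<Longrightarrow> smooth_hull (\<lambda>p. f p * g p)"

lemma smooth_hull_regular:
  assumes "smooth_hull f"
  shows "continuous_on UNIV f \<and>
    (\<forall>c. (\<forall>p. ((\<lambda>t. f (p(c := t))) has_real_derivative jet_partial c f p) (at (p c))) \<and>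
      smooth_hull (jet_partial c f))"
  using assms
proof induction
  case (base f)
  then show ?case
    by (simp add: jet_smooth_continuous jet_smooth_has_derivative' jet_smooth_partial smooth_hull.base del: fun_upd_apply)
next
  case (add f g)
  have d: "((\<lambda>t. f (p(c := t)) + g (p(c := t))) has_real_derivative
      (jet_partial c f p + jet_partial c g p)) (at (p c))" for c p
    using add by (intro DERIV_add) (auto simp del: fun_upd_apply)
  then have "jet_partial c (\<lambda>p. f p + g p) = (\<lambda>p. jet_partial c f p + jet_partial c g p)" for c
    by (intro ext jet_partial_eqI)
  with d add show ?case
    by (auto intro: continuous_on_add smooth_hull.add simp del: fun_upd_apply)
next
  case (mult f g)
  have d: "((\<lambda>t. f (p(c := t)) * g (p(c := t))) has_real_derivative
      (jet_partial c f p * g p + jet_partial c g p * f p)) (at (p c))" for c p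
    using DERIV_mult[of "\<lambda>t. f (p(c := t))" "jet_partial c f p" "p c" UNIV
        "\<lambda>t. g (p(c := t))" "jet_partial c g p"] mult.IH by simp
  then have "jet_partial c (\<lambda>p. f p * g p) =
      (\<lambda>p. jet_partial c f p * g p + jet_partial c g p * f p)" for c
    by (intro ext jet_partial_eqI)
  moreover have "smooth_hull (\<lambda>p. jet_partial c f p * g p + jet_partial c g p * f p)" for c
    using mult by (intro smooth_hull.add smooth_hull.mult) auto
  ultimately show ?case
    using d mult by (auto intro: continuous_on_mult simp del: fun_upd_apply)
qed

lemma smooth_hull_imp_jet_smooth:
  assumes "smooth_hull f"
  shows "jet_smooth f"
  using assms
  by (rule jet_smooth_coinduct[where P = smooth_hull])
    (use smooth_hull_regular in \<open>auto simp: field_differentiable_def\<close>)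

lemma jet_smooth_add: "jet_smooth f \<Longrightarrow> jet_smooth g \<Longrightarrow> jet_smooth (\<lambda>p. f p + g p)"
  and jet_smooth_mult: "jet_smooth f \<Longrightarrow> jet_smooth g \<Longrightarrow> jet_smooth (\<lambda>p. f p * g p)"
  by (simp_all add: smooth_hull_imp_jet_smooth smooth_hull.intros)

text \<open>
  The left-hand side is symmetric in \<open>c\<close> and \<open>d\<close>, which gives the symmetry of second derivatives
  as \<open>h \<longrightarrow> 0\<close>.
\<close>

lemma mixed_difference:
  assumes "jet_smooth f" "c \<noteq> d" "h > 0"
  shows "\<exists>s t. 0 < s \<and> s < h \<and> 0 < t \<and> t < h \<and>
    f (p(c := p c + h, d := p d + h)) - f (p(c := p c + h)) - f (p(d := p d + h)) + f p =
    h * h * jet_partial d (jet_partial c f) (p(c := p c + s, d := p d + t))"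
proof -
  have c: "((\<lambda>s. f (p(d := y, c := s)) - f (p(c := s))) has_real_derivative
     (jet_partial c f (p(d := y, c := s)) - jet_partial c f (p(c := s)))) (at s)" for y s
    by (intro DERIV_diff jet_smooth_has_derivative assms)
  \<comment> \<open>The mean value theorem in \<open>c\<close> is applied to the increment of
    \<open>f\<close> in direction \<open>d\<close>; applied next in \<open>d\<close> to
    \<open>jet_partial c f\<close>, it yields the mixed derivative.\<close>
  have "\<exists>z>p c. z < p c + h \<and>
    (f (p(d := p d + h, c := p c + h)) - f (p(c := p c + h))) -
    (f (p(d := p d + h, c := p c)) - f (p(c := p c))) =
    (p c + h - p c) * (jet_partial c f (p(d := p d + h, c := z)) - jet_partial c f (p(c := z)))"
    by (rule MVT2) (use assms c in \<open>auto simp del: fun_upd_apply\<close>)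
  then obtain s where s: "p c < s" "s < p c + h" and
    eq1: "f (p(d := p d + h, c := p c + h)) - f (p(c := p c + h)) -
      (f (p(d := p d + h)) - f p) =
      h * (jet_partial c f (p(d := p d + h, c := s)) - jet_partial c f (p(c := s)))"
    using \<open>c \<noteq> d\<close> by (auto simp: fun_upd_idem)
  have "\<exists>z>p d. z < p d + h \<and>
    jet_partial c f (p(c := s, d := p d + h)) - jet_partial c f (p(c := s, d := p d)) =
    (p d + h - p d) * jet_partial d (jet_partial c f) (p(c := s, d := z))"
    by (rule MVT2) (use assms in \<open>auto intro: jet_smooth_has_derivative jet_smooth_partial simp del: fun_upd_apply\<close>)
  then obtain t where t: "p d < t" "t < p d + h" and
    eq2: "jet_partial c f (p(c := s, d := p d + h)) - jet_partial c f (p(c := s)) =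
      h * jet_partial d (jet_partial c f) (p(c := s, d := t))"
    using \<open>c \<noteq> d\<close> by (auto simp: fun_upd_idem)
  show ?thesis
    by (rule exI[of _ "s - p c"], rule exI[of _ "t - p d"])
      (use s t eq1 eq2 \<open>c \<noteq> d\<close> in \<open>auto simp: fun_upd_twist\<close>)
qed

lemma continuous_on_fun_upd2:
  fixes p :: "'a \<Rightarrow> 'b::topological_space"
  shows "continuous_on UNIV (\<lambda>x. p(c := fst x, d := snd x))"
proof (rule continuous_on_coordinatewise_then_product)
  show "continuous_on UNIV (\<lambda>x. (p(c := fst x, d := snd x)) i)" for i
    by (cases "i = d"; cases "i = c") (auto intro: continuous_on_fst continuous_on_snd)
qed

lemma jet_partial_commute:
  assumes f: "jet_smooth f"
  shows "jet_partial c (jet_partial d f) = jet_partial d (jet_partial c f)"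
proof (cases "c = d")
  case False
  show ?thesis
  proof
    fix p
    define a where "a s t = jet_partial d (jet_partial c f) (p(c := s, d := t))" for s t
    define b where "b s t = jet_partial c (jet_partial d f) (p(c := s, d := t))" for s t
    have "continuous_on UNIV (\<lambda>x. a (fst x) (snd x))" "continuous_on UNIV (\<lambda>x. b (fst x) (snd x))"
      unfolding a_def b_def
      by (rule continuous_on_compose2[OF jet_smooth_continuous continuous_on_fun_upd2],
          auto intro!: jet_smooth_partial f)+
    then have lim: "(\<lambda>k. a (S k) (T k)) \<longlonglongrightarrow> a s t" "(\<lambda>k. b (S k) (T k)) \<longlonglongrightarrow> b s t"
      if "S \<longlonglongrightarrow> s" "T \<longlonglongrightarrow> t" for S T s t
      using continuous_on_tendsto_compose[where g = "\<lambda>k. (S k, T k)" and F = sequentially and l = "(s, t)"]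
        tendsto_Pair[OF that] by (fastforce simp del: fun_upd_apply)+
    \<comment> \<open>The second difference over a square of side \<open>h\<close> is
      \<open>h * h\<close> times either mixed derivative at some interior point; cancelling
      \<open>h * h\<close> leaves equal values at two points that may differ.\<close>
    have ex: "\<exists>s t s' t'. {s, t, s', t'} \<subseteq> {0<..<h} \<and>
        a (p c + s) (p d + t) = b (p c + s') (p d + t')" if h: "h > 0" for h
    proof -
      obtain s t where st: "{s, t} \<subseteq> {0<..<h}" and
        "f (p(c := p c + h, d := p d + h)) - f (p(c := p c + h)) - f (p(d := p d + h)) + f p =
          h * h * a (p c + s) (p d + t)"
        using mixed_difference[OF f False h, of p] unfolding a_def by auto
      moreover obtain s' t' where st': "{s', t'} \<subseteq> {0<..<h}" and
        "f (p(c := p c + h, d := p d + h)) - f (p(d := p d + h)) - f (p(c := p c + h)) + f p =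
          h * h * b (p c + s') (p d + t')"
        using mixed_difference[OF f False[symmetric] h, of p]
        unfolding b_def fun_upd_twist[OF False] by auto
      ultimately have "h * h * (a (p c + s) (p d + t) - b (p c + s') (p d + t')) = 0"
        by (simp only: right_diff_distrib)
      with st st' h show ?thesis by auto
    qed
    \<comment> \<open>Squares of side \<open>inverse (real (Suc k))\<close> force both intermediate
      points to converge to \<open>p\<close>, where continuity identifies the two
      derivatives.\<close>
    have "\<forall>k. \<exists>s t s' t'. {s, t, s', t'} \<subseteq> {0<..<inverse (real (Suc k))} \<and>
        a (p c + s) (p d + t) = b (p c + s') (p d + t')"
      by (intro allI ex) simp
    then obtain S T S' T' where
      bnd: "\<And>k. {S k, T k, S' k, T' k} \<subseteq> {0<..<inverse (real (Suc k))}" and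
      eq: "\<And>k. a (p c + S k) (p d + T k) = b (p c + S' k) (p d + T' k)"
      by metis
    have "(\<lambda>k. x + X k) \<longlonglongrightarrow> x" if "\<And>k. X k \<in> {0<..<inverse (real (Suc k))}" for X x
    proof -
      have "X \<longlonglongrightarrow> 0"
        by (rule tendsto_sandwich[OF _ _ tendsto_const LIMSEQ_inverse_real_of_nat])
          (use that in \<open>auto intro!: always_eventually less_imp_le\<close>)
      then show ?thesis using tendsto_add[OF tendsto_const, of X 0 _ x] by simp
    qed
    with bnd have "(\<lambda>k. p c + S k) \<longlonglongrightarrow> p c" "(\<lambda>k. p d + T k) \<longlonglongrightarrow> p d"
      "(\<lambda>k. p c + S' k) \<longlonglongrightarrow> p c" "(\<lambda>k. p d + T' k) \<longlonglongrightarrow> p d"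
      by (simp_all add: subset_iff)
    then have "(\<lambda>k. a (p c + S k) (p d + T k)) \<longlonglongrightarrow> a (p c) (p d)"
      "(\<lambda>k. b (p c + S' k) (p d + T' k)) \<longlonglongrightarrow> b (p c) (p d)"
      by (auto intro: lim)
    moreover have "(\<lambda>k. b (p c + S' k) (p d + T' k)) = (\<lambda>k. a (p c + S k) (p d + T k))"
      by (simp add: eq)
    ultimately have "a (p c) (p d) = b (p c) (p d)" by (metis LIMSEQ_unique)
    then show "jet_partial c (jet_partial d f) p = jet_partial d (jet_partial c f) p"
      by (simp add: a_def b_def)
  qed
qed simp

section \<open>The ring of differential functions and total derivatives\<close>

text \<open>Finite dependence as in \<open>diff_function\<close>, but without confining the
  coordinates to \<open>coords n Z\<close>: functions of \<open>u\<close> alone and functions that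
  also involve \<open>v\<close> then lie in one ring.\<close>

definition cylindrical :: "(jet \<Rightarrow> real) \<Rightarrow> bool" where
  "cylindrical f \<longleftrightarrow> (\<exists>C. finite C \<and> (\<forall>p q. (\<forall>c\<in>C. p c = q c) \<longrightarrow> f p = f q))"

lemma cylindrical_const: "cylindrical (\<lambda>p. k)"
  unfolding cylindrical_def by auto

lemma cylindrical_coord: "cylindrical (\<lambda>p. p c)"
  unfolding cylindrical_def by (rule exI[of _ "{c}"]) auto

lemma cylindrical_binop:
  assumes "cylindrical f" "cylindrical g"
  shows "cylindrical (\<lambda>p. h (f p) (g p))"
proof -
  obtain C D where "finite C" "\<And>p q. (\<forall>c\<in>C. p c = q c) \<Longrightarrow> f p = f q"
    and "finite D" "\<And>p q. (\<forall>c\<in>D. p c = q c) \<Longrightarrow> g p = g q"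
    using assms unfolding cylindrical_def by metis
  then show ?thesis
    unfolding cylindrical_def by (intro exI[of _ "C \<union> D"]) (metis Un_iff finite_Un)
qed

lemma cylindrical_partial:
  assumes "cylindrical f"
  shows "cylindrical (jet_partial c f)"
proof -
  obtain C where C: "finite C" "\<And>p q. (\<forall>c\<in>C. p c = q c) \<Longrightarrow> f p = f q"
    using assms unfolding cylindrical_def by metis
  have "jet_partial c f p = jet_partial c f q" if "\<forall>d\<in>insert c C. p d = q d" for p q
  proof -
    have "(\<lambda>t. f (p(c := t))) = (\<lambda>t. f (q(c := t)))"
      by (intro ext C(2)) (use that in auto)
    with that show ?thesis by (simp add: jet_partial_def)
  qed
  with C(1) show ?thesis
    unfolding cylindrical_def by (intro exI[of _ "insert c C"]) auto
qed

lemma jet_partial_outside: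
  assumes "\<And>p q. (\<forall>d\<in>C. p d = q d) \<Longrightarrow> f p = f q" "c \<notin> C"
  shows "jet_partial c f = (\<lambda>p. 0)"
proof (intro ext jet_partial_eqI)
  fix p
  have "(\<lambda>t. f (p(c := t))) = (\<lambda>t. f p)"
    by (intro ext assms(1)) (use assms(2) in auto)
  then show "((\<lambda>t. f (p(c := t))) has_real_derivative 0) (at (p c))"
    by simp
qed

text \<open>With smoothness and finite dependence in the type, the functions form a commutative
  ring, and the identities below are ring calculations free of regularity side conditions.\<close>

typedef jet_fun = "{f. jet_smooth f \<and> cylindrical f}"
  morphisms at_jet Jet_fun
  using jet_smooth_const cylindrical_const by blast

setup_lifting type_definition_jet_fun

instantiation jet_fun :: comm_ring_1
begin

lift_definition zero_jet_fun :: jet_fun is "\<lambda>p. 0"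
  by (simp add: jet_smooth_const cylindrical_const)

lift_definition one_jet_fun :: jet_fun is "\<lambda>p. 1"
  by (simp add: jet_smooth_const cylindrical_const)

lift_definition plus_jet_fun :: "jet_fun \<Rightarrow> jet_fun \<Rightarrow> jet_fun" is "\<lambda>f g p. f p + g p"
  by (simp add: jet_smooth_add cylindrical_binop)

lift_definition times_jet_fun :: "jet_fun \<Rightarrow> jet_fun \<Rightarrow> jet_fun" is "\<lambda>f g p. f p * g p"
  by (simp add: jet_smooth_mult cylindrical_binop)

lift_definition uminus_jet_fun :: "jet_fun \<Rightarrow> jet_fun" is "\<lambda>f p. (- 1) * f p"
  by (intro conjI jet_smooth_mult jet_smooth_const) (auto intro: cylindrical_binop cylindrical_const)

definition minus_jet_fun :: "jet_fun \<Rightarrow> jet_fun \<Rightarrow> jet_fun" where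
  "minus_jet_fun f g = f + - g"

instance
  by standard
    (unfold minus_jet_fun_def, (transfer; auto simp: algebra_simps fun_eq_iff)+)

end

lemma at_jet_zero [simp]: "at_jet 0 p = 0"
  and at_jet_one [simp]: "at_jet 1 p = 1"
  and at_jet_add [simp]: "at_jet (f + g) p = at_jet f p + at_jet g p"
  and at_jet_mult [simp]: "at_jet (f * g) p = at_jet f p * at_jet g p"
  and at_jet_uminus [simp]: "at_jet (- f) p = - at_jet f p"
  by (transfer; simp)+

lemma at_jet_diff [simp]: "at_jet (f - g) p = at_jet f p - at_jet g p"
  by (simp only: minus_jet_fun_def at_jet_add at_jet_uminus)

lemma at_jet_power [simp]: "at_jet (f ^ k) p = at_jet f p ^ k"
  by (induction k) simp_all

lemma at_jet_sum [simp]: "at_jet (sum f A) p = (\<Sum>a\<in>A. at_jet (f a) p)"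
  by (induction A rule: infinite_finite_induct) simp_all

lemma jet_fun_eqI: "(\<And>p. at_jet f p = at_jet g p) \<Longrightarrow> f = g"
  by transfer auto

text \<open>Finite support is required in the ring, not at \<open>p\<close>: otherwise
  \<open>Sum_any g\<close> is 0 by convention, although finitely many of the values at
  \<open>p\<close> may be nonzero.\<close>

lemma at_jet_Sum_any:
  assumes "finite {a. g a \<noteq> 0}"
  shows "at_jet (Sum_any g) p = Sum_any (\<lambda>a. at_jet (g a) p)"
proof -
  have "{a. at_jet (g a) p \<noteq> 0} \<subseteq> {a. g a \<noteq> 0}" by auto
  with assms show ?thesis
    by (simp add: Sum_any.expand_superset[of "{a. g a \<noteq> 0}"])
qed

lift_definition jet_coord :: "coord \<Rightarrow> jet_fun" is "\<lambda>c p. p c"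
  by (simp add: jet_smooth_coord cylindrical_coord)

lift_definition pd :: "coord \<Rightarrow> jet_fun \<Rightarrow> jet_fun" is jet_partial
  by (simp add: jet_smooth_partial cylindrical_partial)

lemma at_jet_coord [simp]: "at_jet (jet_coord c) p = p c"
  by transfer simp

lemma at_jet_pd: "at_jet (pd c f) = jet_partial c (at_jet f)"
  by transfer simp

lemma pd_add: "pd c (f + g) = pd c f + pd c g"
  by transfer (simp add: jet_partial_add)

lemma pd_mult: "pd c (f * g) = pd c f * g + f * pd c g"
  by transfer (simp add: jet_partial_mult)

lemma pd_commute: "pd c (pd d f) = pd d (pd c f)"
  by transfer (simp add: jet_partial_commute)

lemma pd_coord: "pd c (jet_coord d) = (if c = d then 1 else 0)"
  by (cases "c = d"; simp; transfer; simp add: jet_partial_coord)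

lemma pd_one [simp]: "pd c 1 = 0"
  by transfer simp

lemma finite_pd: "finite {c. pd c f \<noteq> 0}"
proof transfer
  fix f assume "jet_smooth f \<and> cylindrical f"
  then obtain C where "finite C" and C: "\<And>p q. (\<forall>d\<in>C. p d = q d) \<Longrightarrow> f p = f q"
    unfolding cylindrical_def by metis
  moreover have "{c. jet_partial c f \<noteq> (\<lambda>p. 0)} \<subseteq> C"
    using jet_partial_outside[of C f] C by blast
  ultimately show "finite {c. jet_partial c f \<noteq> (\<lambda>p. 0)}"
    by (metis finite_subset)
qed

interpretation pd: additive "pd c" for c
  by standard (rule pd_add)

lemmas [simp] = pd.zero

lemma finite_pd_Jet: "finite {J. pd (Jet z J) f \<noteq> 0}"
  by (rule finite_subset[OF _ finite_vimageI[OF finite_pd[of f], of "Jet z"]])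
    (auto intro: injI)

lemma finite_pd_Jets: "finite {(z, J). pd (Jet z J) f \<noteq> 0}"
  by (rule finite_subset[OF _ finite_vimageI[OF finite_pd[of f], of "\<lambda>(z, J). Jet z J"]])
    (auto intro: injI)

section \<open>Total derivatives: Leibniz rule and commutation relations\<close>

definition td :: "nat \<Rightarrow> jet_fun \<Rightarrow> jet_fun" where
  "td i f = pd (Indep i) f +
     Sum_any (\<lambda>(z, J). jet_coord (Jet z (incr_index i J)) * pd (Jet z J) f)"

lemma at_jet_td: "at_jet (td i f) = total_deriv i (at_jet f)"
proof
  fix p
  have "{(z, J). jet_coord (Jet z (incr_index i J)) * pd (Jet z J) f \<noteq> 0} \<subseteq>
      {(z, J). pd (Jet z J) f \<noteq> 0}"
    by auto
  then have "finite {x. (\<lambda>(z, J). jet_coord (Jet z (incr_index i J)) * pd (Jet z J) f) x \<noteq> 0}"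
    using finite_subset[OF _ finite_pd_Jets[of f]] by (simp add: case_prod_unfold)
  then show "at_jet (td i f) p = total_deriv i (at_jet f) p"
    by (simp add: td_def total_deriv_def at_jet_Sum_any at_jet_pd case_prod_unfold)
qed

text \<open>The set summed over in \<open>td\<close> varies with \<open>f\<close>; one finite
  superset for several functions allows their expansions to be combined term by term.\<close>

lemma td_expand:
  assumes "finite T" "\<And>z J. pd (Jet z J) f \<noteq> 0 \<Longrightarrow> (z, J) \<in> T"
  shows "td i f = pd (Indep i) f +
    (\<Sum>(z, J)\<in>T. jet_coord (Jet z (incr_index i J)) * pd (Jet z J) f)"
proof -
  have "{x. (\<lambda>(z, J). jet_coord (Jet z (incr_index i J)) * pd (Jet z J) f) x \<noteq> 0} \<subseteq> T"
    using assms(2) by (metis (mono_tags, lifting) case_prod_beta mem_Collect_eq mult_zero_right prod.collapse subsetI)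
  with assms(1) show ?thesis
    unfolding td_def by (simp add: Sum_any.expand_superset)
qed

lemma td_add: "td i (f + g) = td i f + td i g"
proof -
  let ?T = "{(z, J). pd (Jet z J) f \<noteq> 0} \<union> {(z, J). pd (Jet z J) g \<noteq> 0}"
  have fin: "finite ?T" using finite_pd_Jets by blast
  have ex: "td i h = pd (Indep i) h + (\<Sum>(z, J)\<in>?T. jet_coord (Jet z (incr_index i J)) * pd (Jet z J) h)"
    if "\<And>z J. pd (Jet z J) f = 0 \<Longrightarrow> pd (Jet z J) g = 0 \<Longrightarrow> pd (Jet z J) h = 0" for h
    by (rule td_expand[OF fin]) (use that in auto)
  show ?thesis
    by (subst (1 2 3) ex)
      (simp_all add: pd_add distrib_left sum.distrib case_prod_unfold add.assoc add.left_commute)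
qed

interpretation td: additive "td i" for i
  by standard (rule td_add)

lemmas [simp] = td.zero

lemma td_mult: "td i (f * g) = td i f * g + f * td i g"
proof -
  let ?T = "{(z, J). pd (Jet z J) f \<noteq> 0} \<union> {(z, J). pd (Jet z J) g \<noteq> 0}"
  let ?c = "\<lambda>x. jet_coord (Jet (fst x) (incr_index i (snd x)))"
  let ?d = "\<lambda>x. pd (Jet (fst x) (snd x))"
  have fin: "finite ?T" using finite_pd_Jets by blast
  have ex: "td i h = pd (Indep i) h + (\<Sum>x\<in>?T. ?c x * ?d x h)"
    if "\<And>z J. pd (Jet z J) f = 0 \<Longrightarrow> pd (Jet z J) g = 0 \<Longrightarrow> pd (Jet z J) h = 0" for h
    using td_expand[OF fin, of h i] that by (auto simp: case_prod_unfold)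
  have "td i (f * g) = pd (Indep i) (f * g) + (\<Sum>x\<in>?T. ?c x * ?d x (f * g))"
    by (rule ex) (simp add: pd_mult)
  also have "\<dots> = pd (Indep i) (f * g) + (\<Sum>x\<in>?T. ?c x * ?d x f * g + f * (?c x * ?d x g))"
    by (simp only: pd_mult distrib_left mult.assoc mult.left_commute)
  also have "\<dots> = (pd (Indep i) f + (\<Sum>x\<in>?T. ?c x * ?d x f)) * g +
      f * (pd (Indep i) g + (\<Sum>x\<in>?T. ?c x * ?d x g))"
    by (simp only: pd_mult sum.distrib sum_distrib_left sum_distrib_right distrib_left
        distrib_right ac_simps)
  also have "\<dots> = td i f * g + f * td i g"
    using ex[of f] ex[of g] by simp
  finally show ?thesis .
qed

lemma td_one [simp]: "td i 1 = 0"
  by (simp add: td_def)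

lemma td_coord: "td i (jet_coord (Jet z J)) = jet_coord (Jet z (incr_index i J))"
  by (subst td_expand[of "{(z, J)}"]) (auto simp: pd_coord split: if_splits)

lemma td_pd_expand:
  "td i (pd c f) = pd c (pd (Indep i) f) +
    (\<Sum>x | pd (Jet (fst x) (snd x)) f \<noteq> 0.
      jet_coord (Jet (fst x) (incr_index i (snd x))) * pd c (pd (Jet (fst x) (snd x)) f))"
proof -
  have "td i (pd c f) = pd (Indep i) (pd c f) +
    (\<Sum>(z, J) \<in> {x. pd (Jet (fst x) (snd x)) f \<noteq> 0}.
      jet_coord (Jet z (incr_index i J)) * pd (Jet z J) (pd c f))"
  proof (rule td_expand)
    show "finite {x. pd (Jet (fst x) (snd x)) f \<noteq> 0}"
      using finite_pd_Jets[of f] by (simp add: case_prod_unfold)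
    show "(z, J) \<in> {x. pd (Jet (fst x) (snd x)) f \<noteq> 0}" if "pd (Jet z J) (pd c f) \<noteq> 0" for z J
      using that pd_commute[of "Jet z J" c f] by auto
  qed
  then show ?thesis
    by (simp only: case_prod_unfold pd_commute[of c])
qed

text \<open>The last sum comes from \<open>pd c\<close> hitting the coefficients
  \<open>jet_coord\<close>; the rest is \<open>td i (pd c f)\<close>, in the form given by
  \<open>td_pd_expand\<close>.\<close>

lemma pd_td_expand:
  "pd c (td i f) = pd c (pd (Indep i) f) +
    (\<Sum>x | pd (Jet (fst x) (snd x)) f \<noteq> 0.
      jet_coord (Jet (fst x) (incr_index i (snd x))) * pd c (pd (Jet (fst x) (snd x)) f)) +
    (\<Sum>x | pd (Jet (fst x) (snd x)) f \<noteq> 0.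
      if c = Jet (fst x) (incr_index i (snd x)) then pd (Jet (fst x) (snd x)) f else 0)"
proof -
  have mult_if: "(if P then 1 else 0) * y = (if P then y else 0)" for P and y :: jet_fun
    by simp
  have "td i f = pd (Indep i) f + (\<Sum>(z, J) \<in> {x. pd (Jet (fst x) (snd x)) f \<noteq> 0}.
      jet_coord (Jet z (incr_index i J)) * pd (Jet z J) f)"
    by (rule td_expand) (use finite_pd_Jets[of f] in \<open>simp_all add: case_prod_unfold\<close>)
  also have "pd c \<dots> = pd c (pd (Indep i) f) +
    (\<Sum>x | pd (Jet (fst x) (snd x)) f \<noteq> 0.
      jet_coord (Jet (fst x) (incr_index i (snd x))) * pd c (pd (Jet (fst x) (snd x)) f) +
      (if c = Jet (fst x) (incr_index i (snd x)) then pd (Jet (fst x) (snd x)) f else 0))"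
    by (simp add: pd_add pd.sum pd_mult pd_coord case_prod_unfold mult_if add.commute)
  finally show ?thesis by (simp only: sum.distrib add.assoc)
qed

lemma eq_incr_index_iff: "K = incr_index i J \<longleftrightarrow> K i \<noteq> 0 \<and> J = K(i := K i - 1)"
  unfolding incr_index_def by (auto simp: fun_upd_idem)

text \<open>The coefficient of \<open>pd (Jet z J) f\<close> in \<open>td i f\<close> is the
  coordinate of \<open>incr_index i J\<close>, which is \<open>Jet z K\<close> only for
  \<open>J = K(i := K i - 1)\<close>. The case \<open>K i = 0\<close> is split off because truncated
  subtraction would give a false predecessor there.\<close>

lemma pd_Jet_td:
  "pd (Jet z K) (td i f) = td i (pd (Jet z K) f) +
     (if K i = 0 then 0 else pd (Jet z (K(i := K i - 1))) f)"
proof -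
  let ?T = "{x. pd (Jet (fst x) (snd x)) f \<noteq> 0}"
  let ?K = "K(i := K i - 1)"
  have fin: "finite ?T"
    using finite_pd_Jets[of f] by (simp add: case_prod_unfold)
  have "(if Jet z K = Jet (fst x) (incr_index i (snd x)) then pd (Jet (fst x) (snd x)) f else 0) =
      (if x = (z, ?K) then (if K i = 0 then 0 else pd (Jet z ?K) f) else 0)" for x
    by (cases x) (auto simp: eq_incr_index_iff)
  then have "(\<Sum>x\<in>?T. if Jet z K = Jet (fst x) (incr_index i (snd x)) then pd (Jet (fst x) (snd x)) f else 0) =
      (\<Sum>x\<in>?T. if x = (z, ?K) then (if K i = 0 then 0 else pd (Jet z ?K) f) else 0)"
    by (simp only:)
  also have "\<dots> = (if (z, ?K) \<in> ?T then (if K i = 0 then 0 else pd (Jet z ?K) f) else 0)"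
    by (rule sum.delta[OF fin])
  also have "\<dots> = (if K i = 0 then 0 else pd (Jet z ?K) f)"
    by simp
  finally show ?thesis
    by (simp only: pd_td_expand td_pd_expand)
qed

text \<open>When \<open>i\<close> and \<open>j\<close> are exchanged in the expansion of
  \<open>td i (td j f)\<close>, the sums \<open>A i j\<close> and \<open>A j i\<close> trade places;
  \<open>B\<close> is symmetric by symmetry of second derivatives, and \<open>C\<close> because
  increments of a multi-index commute.\<close>

lemma td_commute: "td i (td j f) = td j (td i f)"
proof -
  let ?T = "{x. pd (Jet (fst x) (snd x)) f \<noteq> 0}"
  let ?c = "\<lambda>i x. jet_coord (Jet (fst x) (incr_index i (snd x)))"
  let ?d = "\<lambda>x. pd (Jet (fst x) (snd x))"
  define A where "A i j = (\<Sum>x\<in>?T. ?c i x * pd (Indep j) (?d x f))" for i j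
  define B where "B i j = (\<Sum>x\<in>?T. \<Sum>y\<in>?T. ?c j x * (?c i y * ?d x (?d y f)))" for i j
  define C where
    "C i j = (\<Sum>x\<in>?T. jet_coord (Jet (fst x) (incr_index i (incr_index j (snd x)))) * ?d x f)" for i j
  have expand: "td i (td j f) = pd (Indep j) (pd (Indep i) f) + A i j + (C i j + (A j i + B i j))" for i j
  proof -
    have "td j f = pd (Indep j) f + (\<Sum>(z, J) \<in> ?T.
        jet_coord (Jet z (incr_index j J)) * pd (Jet z J) f)"
      by (rule td_expand) (use finite_pd_Jets[of f] in \<open>simp_all add: case_prod_unfold\<close>)
    then have "td i (td j f) = td i (pd (Indep j) f) +
        (\<Sum>x\<in>?T. td i (?c j x) * ?d x f + ?c j x * td i (?d x f))"
      by (simp only: td_add td.sum td_mult case_prod_unfold)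
    also have "td i (pd (Indep j) f) = pd (Indep j) (pd (Indep i) f) + A i j"
      by (simp only: td_pd_expand A_def)
    also have "(\<Sum>x\<in>?T. td i (?c j x) * ?d x f + ?c j x * td i (?d x f)) =
        C i j + (\<Sum>x\<in>?T. ?c j x * ?d x (pd (Indep i) f)) + B i j"
      by (simp only: sum.distrib td_coord td_pd_expand C_def B_def distrib_left sum_distrib_left add.assoc)
    also have "(\<Sum>x\<in>?T. ?c j x * ?d x (pd (Indep i) f)) = A j i"
      unfolding A_def by (simp only: pd_commute[of _ "Indep i"])
    finally show ?thesis by (simp only: add.assoc)
  qed
  have B: "B i j = B j i"
  proof -
    have swap: "?c j x * (?c i y * ?d x (?d y f)) = ?c i y * (?c j x * ?d y (?d x f))" for x y
      by (subst pd_commute) (rule mult.left_commute)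
    have "B i j = (\<Sum>y\<in>?T. \<Sum>x\<in>?T. ?c j x * (?c i y * ?d x (?d y f)))"
      unfolding B_def by (rule sum.swap)
    also have "\<dots> = B j i"
      unfolding B_def by (intro sum.cong refl swap)
    finally show ?thesis .
  qed
  have C: "C i j = C j i"
  proof -
    have "incr_index i (incr_index j J) = incr_index j (incr_index i J)" for J
      by (cases "i = j") (simp_all add: incr_index_def fun_upd_twist)
    then show ?thesis unfolding C_def by (simp only:)
  qed
  have P: "pd (Indep j) (pd (Indep i) f) = pd (Indep i) (pd (Indep j) f)"
    by (rule pd_commute)
  have "td i (td j f) = pd (Indep i) (pd (Indep j) f) + A i j + (C j i + (A j i + B j i))"
    by (simp only: expand[of i j] B C P)
  also have "\<dots> = pd (Indep i) (pd (Indep j) f) + A j i + (C j i + (A i j + B j i))"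
    by (simp add: add.assoc add.left_commute)
  also have "\<dots> = td j (td i f)"
    by (rule expand[symmetric])
  finally show ?thesis .
qed

section \<open>Iterated total derivatives\<close>

definition td_list :: "nat list \<Rightarrow> jet_fun \<Rightarrow> jet_fun" where
  "td_list is = foldr td is"

lemma td_list_Nil [simp]: "td_list [] f = f"
  and td_list_Cons [simp]: "td_list (i # is) f = td i (td_list is f)"
  and td_list_append: "td_list (is @ js) f = td_list is (td_list js f)"
  by (simp_all add: td_list_def)

lemma td_list_add: "td_list is (f + g) = td_list is f + td_list is g"
  by (induction "is") (simp_all add: td_add)

interpretation td_list: additive "td_list is" for "is"
  by standard (rule td_list_add)

lemmas [simp] = td_list.zero

lemma td_list_td: "td_list is (td i f) = td i (td_list is f)"
  by (induction "is") (simp_all add: td_commute[of i])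

text \<open>Listing each \<open>i\<close> with multiplicity \<open>J i\<close> makes
  \<open>td_index\<close> an instance of \<open>td_list\<close>, whose properties follow by list
  induction; \<open>at_jet_td_index\<close> identifies it with the nested powers in
  \<open>total_deriv_index\<close>.\<close>

definition index_list :: "nat \<Rightarrow> multi_index \<Rightarrow> nat list" where
  "index_list n J = concat (map (\<lambda>i. replicate (J i) i) [1..<Suc n])"

definition td_index :: "nat \<Rightarrow> multi_index \<Rightarrow> jet_fun \<Rightarrow> jet_fun" where
  "td_index n J = td_list (index_list n J)"

lemma length_index_list: "length (index_list n J) = (\<Sum>i=1..n. J i)"
proof -
  have "length (index_list n J) = (\<Sum>i\<leftarrow>[1..<Suc n]. J i)"
    by (simp add: index_list_def length_concat comp_def del: upt_Suc)
  also have "\<dots> = (\<Sum>i=1..n. J i)"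
    by (simp add: sum_list_distinct_conv_sum_set atLeastLessThanSuc_atLeastAtMost del: upt_Suc)
  finally show ?thesis .
qed

lemma set_index_list: "set (index_list n J) \<subseteq> {1..n}"
  by (auto simp: index_list_def)

interpretation td_index: additive "td_index n J" for n J
  unfolding td_index_def by (rule td_list.additive_axioms)

lemmas [simp] = td_index.zero

lemma td_index_td: "td_index n J (td i f) = td i (td_index n J f)"
  by (simp add: td_index_def td_list_td)

lemma td_index_zero [simp]: "td_index n zero_index f = f"
proof -
  have "concat (map (\<lambda>i. replicate (zero_index i) i) xs) = []" for xs
    by (induction xs) (simp_all add: zero_index_def)
  then show ?thesis by (simp only: td_index_def index_list_def td_list_Nil)
qed

lemma td_index_incr:
  assumes "i \<in> {1..n}"
  shows "td_index n (incr_index i J) f = td i (td_index n J f)"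
proof -
  let ?l = "\<lambda>J xs. concat (map (\<lambda>k. replicate (J k) k) xs)"
  \<comment> \<open>Generalised to distinct lists for the induction: the extra derivative arises
    once, at the position of \<open>i\<close>, and moves to the front because total derivatives
    commute.\<close>
  have "distinct xs \<Longrightarrow> td_list (?l (incr_index i J) xs) f =
      (if i \<in> set xs then td i (td_list (?l J xs) f) else td_list (?l J xs) f)" for xs
  proof (induction xs)
    case (Cons x xs)
    then show ?case
      by (cases "x = i") (simp_all add: td_list_append incr_index_def td_list_td)
  qed simp
  from this[of "[1..<Suc n]"] assms show ?thesis
    by (simp add: td_index_def index_list_def del: upt_Suc)
qed

definition index_sign :: "nat \<Rightarrow> multi_index \<Rightarrow> jet_fun" where
  "index_sign n J = (- 1) ^ (\<Sum>i=1..n. J i)"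

text \<open>Additive operators commute with negation, so this case split carries the sign through
  them without appeal to linearity over constants.\<close>

lemma index_sign_cases: "index_sign n J = 1 \<or> index_sign n J = - 1"
  unfolding index_sign_def by (cases "even (\<Sum>i=1..n. J i)") simp_all

lemma index_sign_incr:
  assumes "i \<in> {1..n}"
  shows "index_sign n (incr_index i J) = - index_sign n J"
proof -
  have "(\<Sum>k=1..n. incr_index i J k) = (\<Sum>k=1..n. J k + (if k = i then 1 else 0))"
    by (intro sum.cong) (auto simp: incr_index_def)
  also have "\<dots> = Suc (\<Sum>k=1..n. J k)"
    using assms by (simp add: sum.distrib)
  finally show ?thesis by (simp add: index_sign_def)
qed

text \<open>The weights \<open>G K\<close> are kept abstract so that one argument serves both
  Frechet adjoints, with signs and total derivatives, and evolutionary fields, with multiplication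
  by \<open>td_index n K (W z)\<close>. Additivity gives \<open>G K 0 = 0\<close>, which bounds the
  support.\<close>

lemma Sum_any_pd_Jet:
  assumes "\<And>K. Modules.additive (G K)" "finite T" "\<And>K. pd (Jet z K) f \<noteq> 0 \<Longrightarrow> K \<in> T"
  shows "Sum_any (\<lambda>K. G K (pd (Jet z K) f)) = (\<Sum>K\<in>T. G K (pd (Jet z K) f))"
proof (rule Sum_any.expand_superset)
  have "G K 0 = 0" for K
    using assms(1) by (rule additive.zero)
  then show "{K. G K (pd (Jet z K) f) \<noteq> 0} \<subseteq> T"
    using assms(3) by (metis (mono_tags, lifting) mem_Collect_eq subsetI)
qed (rule assms)

text \<open>
  Summed form of \<open>\<partial>\<^bsub>z\<^sub>K\<^esub> D\<^sub>i = D\<^sub>i \<partial>\<^bsub>z\<^sub>K\<^esub> + \<partial>\<^bsub>z\<^sub>K - e\<^sub>i\<^esub>\<close>, reindexed to avoid the shift \<open>K - e\<^sub>i\<close>.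
\<close>

lemma Sum_any_pd_td:
  fixes G :: "multi_index \<Rightarrow> jet_fun \<Rightarrow> jet_fun"
  assumes G: "\<And>K. Modules.additive (G K)"
  shows "Sum_any (\<lambda>K. G K (pd (Jet z K) (td i f))) =
    Sum_any (\<lambda>K. G K (td i (pd (Jet z K) f))) + Sum_any (\<lambda>K. G (incr_index i K) (pd (Jet z K) f))"
proof -
  let ?A = "{K. pd (Jet z K) f \<noteq> 0}"
  let ?h = "\<lambda>K. if K i = 0 then 0 else pd (Jet z (K(i := K i - 1))) f"
  let ?T = "?A \<union> incr_index i ` ?A"
  have G0: "G K 0 = 0" for K
    using G by (rule additive.zero)
  have A: "finite ?A" by (rule finite_pd_Jet)
  then have T: "finite ?T" by blast
  have h: "?h K = 0" if "K \<notin> incr_index i ` ?A" for K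
    using that by (auto simp: image_iff eq_incr_index_iff)
  have h_incr: "?h (incr_index i K) = pd (Jet z K) f" for K
    by (simp add: incr_index_def)
  have "pd (Jet z K) (td i f) = 0" if "K \<notin> ?T" for K
    using that h[of K] unfolding pd_Jet_td by auto
  then have "Sum_any (\<lambda>K. G K (pd (Jet z K) (td i f))) = (\<Sum>K\<in>?T. G K (pd (Jet z K) (td i f)))"
    by (intro Sum_any_pd_Jet[OF G T]) blast
  also have "\<dots> = (\<Sum>K\<in>?T. G K (td i (pd (Jet z K) f))) + (\<Sum>K\<in>?T. G K (?h K))"
    by (simp only: pd_Jet_td additive.add[OF G] sum.distrib)
  also have "(\<Sum>K\<in>?T. G K (td i (pd (Jet z K) f))) = Sum_any (\<lambda>K. G K (td i (pd (Jet z K) f)))"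
    by (rule Sum_any.expand_superset[symmetric, OF T]) (use G0 in auto)
  also have "(\<Sum>K\<in>?T. G K (?h K)) = (\<Sum>K\<in>incr_index i ` ?A. G K (?h K))"
    by (rule sum.mono_neutral_right[OF T]) (use h G0 in auto)
  also have "\<dots> = (\<Sum>K\<in>?A. G (incr_index i K) (?h (incr_index i K)))"
  proof (rule sum.reindex[unfolded comp_def])
    show "inj_on (incr_index i) ?A"
      by (rule inj_onI) (metis eq_incr_index_iff)
  qed
  also have "\<dots> = (\<Sum>K\<in>?A. G (incr_index i K) (pd (Jet z K) f))"
    by (simp only: h_incr)
  also have "\<dots> = Sum_any (\<lambda>K. G (incr_index i K) (pd (Jet z K) f))"
    by (rule Sum_any.expand_superset[symmetric, OF A]) (use G0 in auto)
  finally show ?thesis .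
qed

lemma additive_mult_left: "Modules.additive (\<lambda>x::'a::ring. a * x)"
  by (simp_all add: Modules.additive_def algebra_simps)

section \<open>The adjoint of the Frechet derivative and the Euler operator\<close>

text \<open>
  The formal adjoint of the Frechet derivative of \<open>f\<close> in the direction \<open>z\<close>, applied to \<open>g\<close>.
  The variational derivative is the case \<open>g = 1\<close>.
\<close>

definition frechet_adjoint :: "nat \<Rightarrow> depvar \<Rightarrow> jet_fun \<Rightarrow> jet_fun \<Rightarrow> jet_fun" where
  "frechet_adjoint n z f g = Sum_any (\<lambda>K. index_sign n K * td_index n K (pd (Jet z K) f * g))"

lemma additive_frechet_summand: "Modules.additive (\<lambda>x. index_sign n K * td_index n K (x * g))"
  by (simp add: Modules.additive_def distrib_left distrib_right td_index.add)

lemma frechet_adjoint_expand: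
  assumes "finite T" "\<And>K. pd (Jet z K) f \<noteq> 0 \<Longrightarrow> K \<in> T"
  shows "frechet_adjoint n z f g = (\<Sum>K\<in>T. index_sign n K * td_index n K (pd (Jet z K) f * g))"
  unfolding frechet_adjoint_def by (rule Sum_any_pd_Jet[OF additive_frechet_summand assms])

lemma frechet_adjoint_expand_self:
  "frechet_adjoint n z f g =
    (\<Sum>K | pd (Jet z K) f \<noteq> 0. index_sign n K * td_index n K (pd (Jet z K) f * g))"
  by (rule frechet_adjoint_expand) (auto simp: finite_pd_Jet)

lemma frechet_adjoint_add_right:
  "frechet_adjoint n z f (g + h) = frechet_adjoint n z f g + frechet_adjoint n z f h"
  by (simp add: frechet_adjoint_expand_self distrib_left td_index.add sum.distrib)

interpretation frechet_adjoint: additive "frechet_adjoint n z f" for n z f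
  by standard (rule frechet_adjoint_add_right)

text \<open>Sums (\<open>a = b = 1\<close>) and products (\<open>a = g\<close>,
  \<open>b = f\<close>) share this shape; the factors \<open>a\<close> and \<open>b\<close> do not
  depend on \<open>K\<close> and pass into the second argument.\<close>

lemma frechet_adjoint_binop:
  assumes "\<And>K. pd (Jet z K) h = pd (Jet z K) f * a + pd (Jet z K) g * b"
  shows "frechet_adjoint n z h c = frechet_adjoint n z f (a * c) + frechet_adjoint n z g (b * c)"
proof -
  let ?T = "{K. pd (Jet z K) f \<noteq> 0} \<union> {K. pd (Jet z K) g \<noteq> 0}"
  have fin: "finite ?T" using finite_pd_Jet by blast
  have "frechet_adjoint n z h c = (\<Sum>K\<in>?T. index_sign n K * td_index n K (pd (Jet z K) h * c))"
    by (rule frechet_adjoint_expand[OF fin]) (auto simp: assms)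
  also have "\<dots> = (\<Sum>K\<in>?T. index_sign n K * td_index n K (pd (Jet z K) f * (a * c))) +
      (\<Sum>K\<in>?T. index_sign n K * td_index n K (pd (Jet z K) g * (b * c)))"
    by (simp add: assms distrib_left distrib_right td_index.add sum.distrib mult.assoc)
  also have "\<dots> = frechet_adjoint n z f (a * c) + frechet_adjoint n z g (b * c)"
    by (subst (1 2) frechet_adjoint_expand[OF fin]) auto
  finally show ?thesis .
qed

lemma frechet_adjoint_add_left:
  "frechet_adjoint n z (f + g) h = frechet_adjoint n z f h + frechet_adjoint n z g h"
  using frechet_adjoint_binop[of z "f + g" f 1 g 1 n h] by (simp add: pd_add)

interpretation frechet_adjoint_left: additive "\<lambda>f. frechet_adjoint n z f g" for n z g
  by standard (rule frechet_adjoint_add_left)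

lemma frechet_adjoint_mult:
  "frechet_adjoint n z (f * g) h = frechet_adjoint n z f (g * h) + frechet_adjoint n z g (f * h)"
  by (rule frechet_adjoint_binop) (simp add: pd_mult mult.commute)

text \<open>The shifted part of \<open>Sum_any_pd_td\<close> has the terms
  \<open>- index_sign n K * td_index n K (td i (pd (Jet z K) f * g))\<close>. By the Leibniz rule
  they cancel the other part and leave the derivative on \<open>g\<close>, with a minus
  sign.\<close>

lemma frechet_adjoint_td:
  assumes i: "i \<in> {1..n}"
  shows "frechet_adjoint n z (td i f) g = - frechet_adjoint n z f (td i g)"
proof -
  let ?A = "{K. pd (Jet z K) f \<noteq> 0}"
  let ?G = "\<lambda>K x. index_sign n K * td_index n K (x * g)"
  have A: "finite ?A" by (rule finite_pd_Jet)
  have "frechet_adjoint n z (td i f) g =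
      Sum_any (\<lambda>K. ?G K (td i (pd (Jet z K) f))) + Sum_any (\<lambda>K. ?G (incr_index i K) (pd (Jet z K) f))"
    unfolding frechet_adjoint_def by (rule Sum_any_pd_td) (rule additive_frechet_summand)
  also have "Sum_any (\<lambda>K. ?G K (td i (pd (Jet z K) f))) = (\<Sum>K\<in>?A. ?G K (td i (pd (Jet z K) f)))"
    by (rule Sum_any.expand_superset[OF A]) auto
  also have "Sum_any (\<lambda>K. ?G (incr_index i K) (pd (Jet z K) f)) =
      (\<Sum>K\<in>?A. ?G (incr_index i K) (pd (Jet z K) f))"
    by (rule Sum_any.expand_superset[OF A]) auto
  also have "(\<Sum>K\<in>?A. ?G K (td i (pd (Jet z K) f))) + (\<Sum>K\<in>?A. ?G (incr_index i K) (pd (Jet z K) f)) =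
      (\<Sum>K\<in>?A. - (index_sign n K * td_index n K (pd (Jet z K) f * td i g)))"
    unfolding sum.distrib[symmetric]
    by (intro sum.cong refl)
      (simp add: td_index_incr[OF i] index_sign_incr[OF i] td_index_td[symmetric] td_mult
        td_index.add distrib_left)
  also have "\<dots> = - frechet_adjoint n z f (td i g)"
    by (simp add: sum_negf frechet_adjoint_expand_self)
  finally show ?thesis .
qed

lemma frechet_adjoint_td_list:
  "set is \<subseteq> {1..n} \<Longrightarrow>
   frechet_adjoint n z (td_list is f) g = (- 1) ^ length is * frechet_adjoint n z f (td_list is g)"
proof (induction "is" arbitrary: g)
  case (Cons i "is")
  then show ?case
    by (simp add: frechet_adjoint_td td_list_td frechet_adjoint.minus)
qed simp

lemma frechet_adjoint_td_index:
  "frechet_adjoint n z (td_index n J f) g = frechet_adjoint n z f (index_sign n J * td_index n J g)"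
  unfolding td_index_def frechet_adjoint_td_list[OF set_index_list] length_index_list
    index_sign_def[symmetric]
  using index_sign_cases[of n J] by (auto simp: frechet_adjoint.minus)

definition euler :: "nat \<Rightarrow> depvar \<Rightarrow> jet_fun \<Rightarrow> jet_fun" where
  "euler n z f = frechet_adjoint n z f 1"

interpretation euler: additive "euler n z" for n z
  unfolding euler_def by (rule frechet_adjoint_left.additive_axioms)

lemma euler_mult: "euler n z (f * g) = frechet_adjoint n z f g + frechet_adjoint n z g f"
  by (simp add: euler_def frechet_adjoint_mult)

text \<open>Divergences are null Lagrangians: the derivative moves onto the constant 1.\<close>

lemma euler_td: "i \<in> {1..n} \<Longrightarrow> euler n z (td i f) = 0"
  by (simp add: euler_def frechet_adjoint_td frechet_adjoint.zero)

lemma euler_expand: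
  assumes "finite T" "\<And>K. pd (Jet z K) f \<noteq> 0 \<Longrightarrow> K \<in> T"
  shows "euler n z f = (\<Sum>K\<in>T. index_sign n K * td_index n K (pd (Jet z K) f))"
  unfolding euler_def by (simp add: frechet_adjoint_expand[OF assms])

text \<open>Integration by parts: by \<open>euler_mult\<close> both factors contribute, and in each
  contribution the derivatives change sides of \<open>frechet_adjoint\<close> with the same
  sign.\<close>

lemma euler_mult_td_list:
  assumes "set is \<subseteq> {1..n}"
  shows "euler n z (f * td_list is g) = (- 1) ^ length is * euler n z (g * td_list is f)"
  using frechet_adjoint_td_list[OF assms] by (simp add: euler_mult algebra_simps)

section \<open>Evolutionary vector fields and differential ideals\<close>

text \<open>The evolutionary vector field with characteristic \<open>W\<close>.\<close>

definition evol :: "nat \<Rightarrow> depvar set \<Rightarrow> (depvar \<Rightarrow> jet_fun) \<Rightarrow> jet_fun \<Rightarrow> jet_fun" where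
  "evol n Z W f = (\<Sum>z\<in>Z. Sum_any (\<lambda>J. td_index n J (W z) * pd (Jet z J) f))"

lemma evol_expand:
  assumes "finite T" "\<And>z J. pd (Jet z J) f \<noteq> 0 \<Longrightarrow> J \<in> T"
  shows "evol n Z W f = (\<Sum>z\<in>Z. \<Sum>J\<in>T. td_index n J (W z) * pd (Jet z J) f)"
  unfolding evol_def
  by (intro sum.cong refl Sum_any_pd_Jet additive_mult_left assms)

lemma ex_Jet_support: "\<exists>T. finite T \<and> (\<forall>z J. pd (Jet z J) f \<noteq> 0 \<longrightarrow> J \<in> T)"
  by (rule exI[of _ "snd ` {(z, J). pd (Jet z J) f \<noteq> 0}"]) (force intro: finite_pd_Jets)

lemma ex_Jet_support2:
  "\<exists>T. finite T \<and> (\<forall>z J. pd (Jet z J) f \<noteq> 0 \<longrightarrow> J \<in> T) \<and> (\<forall>z J. pd (Jet z J) g \<noteq> 0 \<longrightarrow> J \<in> T)"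
  by (metis ex_Jet_support Un_iff finite_Un)

lemma evol_add: "evol n Z W (f + g) = evol n Z W f + evol n Z W g"
proof -
  obtain T where T: "finite T" "\<And>z J. pd (Jet z J) f \<noteq> 0 \<Longrightarrow> J \<in> T"
    "\<And>z J. pd (Jet z J) g \<noteq> 0 \<Longrightarrow> J \<in> T"
    using ex_Jet_support2 by metis
  have "pd (Jet z J) (f + g) \<noteq> 0 \<Longrightarrow> J \<in> T" for z J
    using T(2,3)[of z J] by (cases "pd (Jet z J) f = 0") (auto simp: pd_add)
  then have "evol n Z W (f + g) = (\<Sum>z\<in>Z. \<Sum>J\<in>T. td_index n J (W z) * pd (Jet z J) (f + g))"
    by (rule evol_expand[OF T(1)])
  then show ?thesis
    by (simp add: evol_expand[OF T(1,2)] evol_expand[OF T(1,3)] pd_add distrib_left sum.distrib)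
qed

interpretation evol: additive "evol n Z W" for n Z W
  by standard (rule evol_add)

lemma evol_mult: "evol n Z W (f * g) = evol n Z W f * g + f * evol n Z W g"
proof -
  obtain T where T: "finite T" "\<And>z J. pd (Jet z J) f \<noteq> 0 \<Longrightarrow> J \<in> T"
    "\<And>z J. pd (Jet z J) g \<noteq> 0 \<Longrightarrow> J \<in> T"
    using ex_Jet_support2 by metis
  have "pd (Jet z J) (f * g) \<noteq> 0 \<Longrightarrow> J \<in> T" for z J
    using T(2,3)[of z J] by (cases "pd (Jet z J) f = 0"; cases "pd (Jet z J) g = 0") (auto simp: pd_mult)
  then have "evol n Z W (f * g) = (\<Sum>z\<in>Z. \<Sum>J\<in>T. td_index n J (W z) * pd (Jet z J) (f * g))"
    by (rule evol_expand[OF T(1)])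
  also have "\<dots> = (\<Sum>z\<in>Z. \<Sum>J\<in>T. td_index n J (W z) * pd (Jet z J) f * g +
      f * (td_index n J (W z) * pd (Jet z J) g))"
    by (simp add: pd_mult distrib_left mult.assoc mult.left_commute)
  also have "\<dots> = evol n Z W f * g + f * evol n Z W g"
    by (simp add: evol_expand[OF T(1,2)] evol_expand[OF T(1,3)] sum.distrib sum_distrib_left sum_distrib_right)
  finally show ?thesis .
qed

lemma evol_index_sign_mult: "evol n Z W (index_sign m J * f) = index_sign m J * evol n Z W f"
  using index_sign_cases[of m J] by (auto simp: evol.minus)

text \<open>In the shifted part of \<open>Sum_any_pd_td\<close> the coefficient becomes
  \<open>td i (td_index n J (W z))\<close>, exactly the missing half of the Leibniz rule.\<close>

lemma evol_td:
  assumes i: "i \<in> {1..n}"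
  shows "evol n Z W (td i f) = td i (evol n Z W f)"
proof -
  obtain T where T: "finite T" "\<And>z J. pd (Jet z J) f \<noteq> 0 \<Longrightarrow> J \<in> T"
    using ex_Jet_support by metis
  have z: "Sum_any (\<lambda>J. td_index n J (W z) * pd (Jet z J) (td i f)) =
      (\<Sum>J\<in>T. td i (td_index n J (W z) * pd (Jet z J) f))" for z
  proof -
    have "Sum_any (\<lambda>J. td_index n J (W z) * pd (Jet z J) (td i f)) =
      Sum_any (\<lambda>J. td_index n J (W z) * td i (pd (Jet z J) f)) +
      Sum_any (\<lambda>J. td_index n (incr_index i J) (W z) * pd (Jet z J) f)"
      by (rule Sum_any_pd_td) (rule additive_mult_left)
    also have "Sum_any (\<lambda>J. td_index n J (W z) * td i (pd (Jet z J) f)) =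
        (\<Sum>J\<in>T. td_index n J (W z) * td i (pd (Jet z J) f))"
      by (rule Sum_any.expand_superset[OF T(1)]) (use T(2)[of z] in force)
    also have "Sum_any (\<lambda>J. td_index n (incr_index i J) (W z) * pd (Jet z J) f) =
        (\<Sum>J\<in>T. td_index n (incr_index i J) (W z) * pd (Jet z J) f)"
      by (rule Sum_any.expand_superset[OF T(1)]) (use T(2)[of z] in force)
    finally show ?thesis
      by (simp add: td_mult td_index_incr[OF i] sum.distrib add.commute)
  qed
  have "evol n Z W (td i f) = (\<Sum>z\<in>Z. \<Sum>J\<in>T. td i (td_index n J (W z) * pd (Jet z J) f))"
    by (simp only: evol_def z)
  then show ?thesis
    by (simp only: evol_expand[OF T] td.sum)
qed

lemma evol_td_list: "set is \<subseteq> {1..n} \<Longrightarrow> evol n Z W (td_list is f) = td_list is (evol n Z W f)"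
  by (induction "is") (simp_all add: evol_td)

lemma evol_td_index: "evol n Z W (td_index n J f) = td_index n J (evol n Z W f)"
  unfolding td_index_def by (rule evol_td_list[OF set_index_list])

text \<open>\<open>euler_mult\<close> splits the contribution of each summand
  \<open>td_index n J (W y) * pd (Jet y J) f\<close> in two. In the one that differentiates
  \<open>W y\<close>, \<open>frechet_adjoint_td_index\<close> moves the total derivatives to
  \<open>pd (Jet y J) f\<close>, and the sum over \<open>J\<close> becomes
  \<open>euler n y f\<close>. In the other, exchanging the partial derivatives gives
  \<open>evol\<close> of \<open>pd (Jet z K) f\<close>, and \<open>evol\<close> commutes with total
  derivatives.\<close>

lemma euler_evol:
  assumes "finite Z"
  shows "euler n z (evol n Z W f) =
    evol n Z W (euler n z f) + (\<Sum>y\<in>Z. frechet_adjoint n z (W y) (euler n y f))"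
proof -
  obtain T where T: "finite T" "\<And>z J. pd (Jet z J) f \<noteq> 0 \<Longrightarrow> J \<in> T"
    using ex_Jet_support by metis
  have T': "J \<in> T" if "pd (Jet y J) (pd c f) \<noteq> 0" for y J c
    using that T(2)[of y J] pd_commute[of "Jet y J" c f] by (cases "pd (Jet y J) f = 0") auto
  have "euler n z (evol n Z W f) = (\<Sum>y\<in>Z. \<Sum>J\<in>T.
      frechet_adjoint n z (td_index n J (W y)) (pd (Jet y J) f) +
      frechet_adjoint n z (pd (Jet y J) f) (td_index n J (W y)))"
    by (simp only: evol_expand[OF T] euler.sum euler_mult)
  also have "\<dots> = (\<Sum>y\<in>Z. \<Sum>J\<in>T. frechet_adjoint n z (td_index n J (W y)) (pd (Jet y J) f)) +
      (\<Sum>y\<in>Z. \<Sum>J\<in>T. frechet_adjoint n z (pd (Jet y J) f) (td_index n J (W y)))"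
    by (simp only: sum.distrib)
  also have "(\<Sum>y\<in>Z. \<Sum>J\<in>T. frechet_adjoint n z (td_index n J (W y)) (pd (Jet y J) f)) =
      (\<Sum>y\<in>Z. frechet_adjoint n z (W y) (euler n y f))"
    by (simp only: euler_expand[OF T] frechet_adjoint_td_index frechet_adjoint.sum)
  also have "(\<Sum>y\<in>Z. \<Sum>J\<in>T. frechet_adjoint n z (pd (Jet y J) f) (td_index n J (W y))) =
      (\<Sum>y\<in>Z. \<Sum>J\<in>T. \<Sum>K\<in>T.
        index_sign n K * td_index n K (td_index n J (W y) * pd (Jet y J) (pd (Jet z K) f)))"
    by (intro sum.cong refl)
      (simp add: frechet_adjoint_expand[OF T(1) T'] pd_commute[of "Jet z _"] mult.commute)
  also have "\<dots> = (\<Sum>y\<in>Z. \<Sum>K\<in>T. \<Sum>J\<in>T.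
        index_sign n K * td_index n K (td_index n J (W y) * pd (Jet y J) (pd (Jet z K) f)))"
    by (rule sum.cong[OF refl]) (rule sum.swap)
  also have "\<dots> = (\<Sum>K\<in>T. \<Sum>y\<in>Z. \<Sum>J\<in>T.
        index_sign n K * td_index n K (td_index n J (W y) * pd (Jet y J) (pd (Jet z K) f)))"
    by (rule sum.swap)
  also have "\<dots> = (\<Sum>K\<in>T. index_sign n K * td_index n K (evol n Z W (pd (Jet z K) f)))"
    by (simp only: evol_expand[OF T(1) T'] td_index.sum sum_distrib_left)
  also have "\<dots> = evol n Z W (euler n z f)"
    by (simp only: euler_expand[OF T] evol.sum evol_index_sign_mult evol_td_index)
  finally show ?thesis by (simp only: add.commute)
qed

text \<open>The generators are the total derivatives of members of \<open>S\<close>, the very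
  quantities that \<open>admits\<close> sets to 0; closure under \<open>td\<close> is then a
  consequence.\<close>

inductive diff_ideal :: "nat \<Rightarrow> jet_fun set \<Rightarrow> jet_fun \<Rightarrow> bool" for n S where
  base: "G \<in> S \<Longrightarrow> diff_ideal n S (td_index n J G)"
| zero: "diff_ideal n S 0"
| add: "diff_ideal n S f \<Longrightarrow> diff_ideal n S g \<Longrightarrow> diff_ideal n S (f + g)"
| mult: "diff_ideal n S f \<Longrightarrow> diff_ideal n S (g * f)"

lemma diff_ideal_vanishes:
  assumes "diff_ideal n S f" "\<And>G J. G \<in> S \<Longrightarrow> at_jet (td_index n J G) p = 0"
  shows "at_jet f p = 0"
  using assms by induction simp_all

lemma diff_ideal_td:
  assumes "diff_ideal n S f" "i \<in> {1..n}"
  shows "diff_ideal n S (td i f)"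
  using assms
proof induction
  case (base G J)
  then have "td i (td_index n J G) = td_index n (incr_index i J) G"
    by (simp add: td_index_incr)
  then show ?case using base by (simp add: diff_ideal.base)
next
  case (mult f g)
  have "td i (g * f) = td i g * f + g * td i f" by (rule td_mult)
  then show ?case using mult by (simp add: diff_ideal.add diff_ideal.mult)
qed (simp_all add: td_add diff_ideal.intros)

lemma diff_ideal_td_list:
  "diff_ideal n S f \<Longrightarrow> set is \<subseteq> {1..n} \<Longrightarrow> diff_ideal n S (td_list is f)"
  by (induction "is") (simp_all add: diff_ideal_td)

lemma diff_ideal_sum:
  "(\<And>a. a \<in> A \<Longrightarrow> diff_ideal n S (f a)) \<Longrightarrow> diff_ideal n S (sum f A)"
  by (induction A rule: infinite_finite_induct) (simp_all add: diff_ideal.intros)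

lemma diff_ideal_generator: "G \<in> S \<Longrightarrow> diff_ideal n S G"
  using diff_ideal.base[of G S n zero_index] by simp

lemma diff_ideal_frechet_adjoint:
  assumes "diff_ideal n S g"
  shows "diff_ideal n S (frechet_adjoint n z f g)"
  unfolding frechet_adjoint_expand_self td_index_def
  by (intro diff_ideal_sum diff_ideal.mult diff_ideal_td_list set_index_list assms)

section \<open>Adjoint equations\<close>

lemma at_jet_td_list: "at_jet (td_list is f) = total_deriv_list is (at_jet f)"
  by (induction "is") (simp_all add: total_deriv_list_def at_jet_td)

lemma at_jet_td_index: "at_jet (td_index n J f) = total_deriv_index n J (at_jet f)"
proof -
  have pow: "at_jet (td_list (replicate k i) f) = (total_deriv i ^^ k) (at_jet f)" for k i f
    by (induction k) (simp_all add: at_jet_td)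
  have "at_jet (td_list (concat (map (\<lambda>i. replicate (J i) i) xs)) f) =
      foldr (\<lambda>i. total_deriv i ^^ J i) xs (at_jet f)" for xs
    by (induction xs) (simp_all add: td_list_append pow)
  then show ?thesis
    by (simp only: td_index_def index_list_def total_deriv_index_def)
qed

lemma at_jet_index_sign: "at_jet (index_sign n J) p = (- 1) ^ (\<Sum>i=1..n. J i)"
  by (simp add: index_sign_def)

lemma at_jet_euler: "at_jet (euler n z f) = variational_deriv n z (at_jet f)"
proof
  fix p
  have "{J. index_sign n J * td_index n J (pd (Jet z J) f * 1) \<noteq> 0} \<subseteq> {J. pd (Jet z J) f \<noteq> 0}"
    by auto
  then have "finite {J. index_sign n J * td_index n J (pd (Jet z J) f * 1) \<noteq> 0}"
    by (rule finite_subset) (rule finite_pd_Jet)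
  then show "at_jet (euler n z f) p = variational_deriv n z (at_jet f) p"
    by (simp add: euler_def frechet_adjoint_def at_jet_Sum_any variational_deriv_def
        at_jet_index_sign at_jet_td_index at_jet_pd)
qed

section \<open>Prolongation of Lie-Baecklund operators\<close>

definition lie_char ::
  "nat \<Rightarrow> (nat \<Rightarrow> jet_fun) \<Rightarrow> (depvar \<Rightarrow> jet_fun) \<Rightarrow> depvar \<Rightarrow> jet_fun" where
  "lie_char n x y z = y z - (\<Sum>i=1..n. x i * jet_coord (Jet z (incr_index i zero_index)))"

definition prolong ::
  "nat \<Rightarrow> depvar set \<Rightarrow> (nat \<Rightarrow> jet_fun) \<Rightarrow> (depvar \<Rightarrow> jet_fun) \<Rightarrow> jet_fun \<Rightarrow> jet_fun" where
  "prolong n Z x y f = (\<Sum>i=1..n. x i * td i f) + evol n Z (lie_char n x y) f"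

text \<open>Agreement is asked only on the ranges of summation, because outside them
  \<open>Jet_fun\<close> may be applied to functions that represent no element of the ring.\<close>

lemma at_jet_prolong:
  assumes x: "\<And>i. i \<in> {1..n} \<Longrightarrow> at_jet (x i) = \<xi> i"
    and y: "\<And>z. z \<in> Z \<Longrightarrow> at_jet (y z) = \<zeta> z"
  shows "at_jet (prolong n Z x y f) p = prolongation n Z \<xi> \<zeta> (at_jet f) p"
proof -
  have "at_jet (lie_char n x y z) = characteristic n \<xi> \<zeta> z" if "z \<in> Z" for z
    using that by (auto simp: fun_eq_iff lie_char_def characteristic_def x y intro!: sum.cong)
  moreover have "finite {J. td_index n J (W z) * pd (Jet z J) f \<noteq> 0}" for W :: "depvar \<Rightarrow> jet_fun" and z
    by (rule finite_subset[OF _ finite_pd_Jet[of z f]]) auto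
  ultimately show ?thesis
    by (simp add: prolong_def prolongation_def evol_def at_jet_Sum_any at_jet_td x at_jet_td_index
        at_jet_pd)
qed

lemma prolong_add: "prolong n Z x y (f + g) = prolong n Z x y f + prolong n Z x y g"
  by (simp add: prolong_def td_add evol_add distrib_left sum.distrib)

interpretation prolong: additive "prolong n Z x y" for n Z x y
  by standard (rule prolong_add)

lemma prolong_mult: "prolong n Z x y (f * g) = prolong n Z x y f * g + f * prolong n Z x y g"
  by (simp add: prolong_def td_mult evol_mult distrib_left distrib_right sum.distrib
      sum_distrib_left sum_distrib_right ac_simps)

text \<open>The transport terms \<open>x i * td i\<close> produce the first derivatives of
  \<open>z\<close>, which cancel those subtracted in \<open>lie_char\<close>.\<close>

lemma prolong_coord:
  assumes "finite Z" "z \<in> Z"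
  shows "prolong n Z x y (jet_coord (Jet z zero_index)) = y z"
proof -
  have "evol n Z W (jet_coord (Jet z zero_index)) = W z" for W
  proof -
    have "evol n Z W (jet_coord (Jet z zero_index)) =
        (\<Sum>z'\<in>Z. \<Sum>J\<in>{zero_index}. td_index n J (W z') * pd (Jet z' J) (jet_coord (Jet z zero_index)))"
      by (rule evol_expand) (auto simp: pd_coord split: if_splits)
    also have "\<dots> = (\<Sum>z'\<in>Z. if z' = z then W z' else 0)"
      by (intro sum.cong) (auto simp: pd_coord)
    also have "\<dots> = W z"
      using assms by simp
    finally show ?thesis .
  qed
  then show ?thesis by (simp add: prolong_def lie_char_def td_coord)
qed

lemma prolong_mono_neutral:
  assumes "finite Z'" "Z \<subseteq> Z'" "\<And>z J. z \<in> Z' - Z \<Longrightarrow> pd (Jet z J) f = 0"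
  shows "prolong n Z' x y f = prolong n Z x y f"
proof -
  have "evol n Z' W f = evol n Z W f" for W
    unfolding evol_def using assms by (intro sum.mono_neutral_right) auto
  then show ?thesis by (simp add: prolong_def)
qed

section \<open>Differential operators and their formal adjoints\<close>

definition diff_op :: "nat \<Rightarrow> nat \<Rightarrow> (nat list \<Rightarrow> jet_fun) \<Rightarrow> jet_fun \<Rightarrow> jet_fun" where
  "diff_op n r c f = (\<Sum>k\<le>r. \<Sum>is\<in>index_lists n k. c is * td_list is f)"

definition adj_op :: "nat \<Rightarrow> nat \<Rightarrow> (nat list \<Rightarrow> jet_fun) \<Rightarrow> jet_fun \<Rightarrow> jet_fun" where
  "adj_op n r c f = (\<Sum>k\<le>r. (- 1) ^ k * (\<Sum>is\<in>index_lists n k. td_list is (f * c is)))"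

lemma at_jet_diff_op:
  assumes "\<And>k is. k \<le> r \<Longrightarrow> is \<in> index_lists n k \<Longrightarrow> at_jet (c is) = lam is"
  shows "at_jet (diff_op n r c f) p = diff_operator n r lam (at_jet f) p"
  using assms by (auto simp: diff_op_def diff_operator_def at_jet_td_list intro!: sum.cong)

lemma at_jet_adj_op:
  assumes "\<And>k is. k \<le> r \<Longrightarrow> is \<in> index_lists n k \<Longrightarrow> at_jet (c is) = lam is"
  shows "at_jet (adj_op n r c f) p = adjoint_operator n r lam (at_jet f) p"
proof -
  have "at_jet (f * c is) = (\<lambda>q. at_jet f q * lam is q)" if "k \<le> r" "is \<in> index_lists n k" for k "is"
    using assms[OF that] by (auto simp: fun_eq_iff)
  then show ?thesis
    by (auto simp: adj_op_def adjoint_operator_def at_jet_td_list intro!: sum.cong)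
qed

text \<open>Lagrange's identity as seen by the Euler operator: \<open>f * diff_op n r c g\<close>
  and \<open>adj_op n r c f * g\<close> differ by a divergence. Each term is an instance of
  \<open>euler_mult_td_list\<close>.\<close>

lemma euler_diff_op: "euler n z (f * diff_op n r c g) = euler n z (adj_op n r c f * g)"
proof -
  have "euler n z (f * diff_op n r c g) =
      (\<Sum>k\<le>r. \<Sum>is\<in>index_lists n k. euler n z (f * c is * td_list is g))"
    by (simp add: diff_op_def sum_distrib_left euler.sum mult.assoc)
  also have "\<dots> = (\<Sum>k\<le>r. \<Sum>is\<in>index_lists n k. (- 1) ^ k * euler n z (g * td_list is (f * c is)))"
  proof (intro sum.cong refl)
    fix k "is" assume "is \<in> index_lists n k"
    then show "euler n z (f * c is * td_list is g) = (- 1) ^ k * euler n z (g * td_list is (f * c is))"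
      using euler_mult_td_list[of "is" n z "f * c is" g] by (simp add: index_lists_def)
  qed
  also have "\<dots> = (\<Sum>k\<le>r. \<Sum>is\<in>index_lists n k. euler n z ((- 1) ^ k * td_list is (f * c is) * g))"
  proof (intro sum.cong refl)
    fix k "is"
    show "(- 1) ^ k * euler n z (g * td_list is (f * c is)) =
        euler n z ((- 1) ^ k * td_list is (f * c is) * g)"
      by (cases "even k") (simp_all add: euler.minus mult.commute)
  qed
  also have "\<dots> = euler n z (adj_op n r c f * g)"
    by (simp add: adj_op_def sum_distrib_left sum_distrib_right euler.sum)
  finally show ?thesis .
qed

section \<open>The Lagrangian and the enlarged system\<close>

definition w_jet :: "nat \<Rightarrow> nat \<Rightarrow> jet_fun" where
  "w_jet mt \<beta> = jet_coord (Jet (V \<beta>) zero_index) + (\<Sum>\<gamma>=1..mt. jet_coord (Jet (Vt \<gamma>) zero_index))"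

text \<open>In \<open>adjoint_lagrangian\<close> the sum of the variables \<open>Vt\<close>
  multiplies every \<open>F\<close>; collected by equation, it joins \<open>V \<beta>\<close> in the
  weight \<open>w_jet mt \<beta>\<close>.\<close>

definition lagrangian :: "nat \<Rightarrow> nat \<Rightarrow> (nat \<Rightarrow> jet_fun) \<Rightarrow> jet_fun" where
  "lagrangian m mt F = (\<Sum>\<beta>=1..m. w_jet mt \<beta> * F \<beta>)"

lemma at_jet_w_jet: "at_jet (w_jet mt \<beta>) = w_fun mt \<beta>"
  by (auto simp: fun_eq_iff w_jet_def w_fun_def)

lemma at_jet_lagrangian:
  assumes "\<And>\<beta>. \<beta> \<in> {1..m} \<Longrightarrow> at_jet (Fj \<beta>) = F \<beta>"
  shows "at_jet (lagrangian m mt Fj) = adjoint_lagrangian m mt F"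
  using assms
  by (simp add: fun_eq_iff lagrangian_def adjoint_lagrangian_def at_jet_w_jet w_fun_def
      distrib_right sum.distrib sum_distrib_left)

definition adjoint_system :: "nat \<Rightarrow> nat \<Rightarrow> nat \<Rightarrow> (nat \<Rightarrow> jet_fun) \<Rightarrow> jet_fun set" where
  "adjoint_system n m mt F =
    (\<lambda>\<alpha>. euler n (U \<alpha>) (lagrangian m mt F)) ` {1..m} \<union>
    (\<lambda>\<alpha>. euler n (Ut \<alpha>) (lagrangian m mt F)) ` {1..mt} \<union> F ` {1..m}"

lemma finite_uv_vars: "finite (uv_vars m mt)"
  by (simp add: uv_vars_def u_vars_def)

lemma u_vars_subset_uv_vars: "u_vars m mt \<subseteq> uv_vars m mt"
  by (auto simp: uv_vars_def)

lemma diff_ideal_uminus: "diff_ideal n S f \<Longrightarrow> diff_ideal n S (- f)"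
  using diff_ideal.mult[of n S f "- 1"] by simp

text \<open>Stated for all \<open>z\<close>, since \<open>euler_evol\<close> sums over the
  \<open>v\<close> variables too. For \<open>z\<close> outside \<open>u_vars\<close> only the
  weights can depend on \<open>z\<close>, and their Frechet adjoints are applied to the equations
  \<open>F\<close>, which belong to the system.\<close>

lemma diff_ideal_euler_lagrangian:
  assumes F: "\<And>\<nu> z J. \<nu> \<in> {1..m} \<Longrightarrow> z \<notin> u_vars m mt \<Longrightarrow> pd (Jet z J) (F \<nu>) = 0"
  shows "diff_ideal n (adjoint_system n m mt F) (euler n z (lagrangian m mt F))"
proof (cases "z \<in> u_vars m mt")
  case True
  then show ?thesis
    by (auto simp: u_vars_def adjoint_system_def intro!: diff_ideal_generator)
next
  case False
  have "frechet_adjoint n z (F \<beta>) (w_jet mt \<beta>) = 0" if "\<beta> \<in> {1..m}" for \<beta>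
    using F[OF that False] by (simp add: frechet_adjoint_def)
  then have "euler n z (lagrangian m mt F) = (\<Sum>\<beta>=1..m. frechet_adjoint n z (w_jet mt \<beta>) (F \<beta>))"
    by (simp add: lagrangian_def euler.sum euler_mult)
  also have "diff_ideal n (adjoint_system n m mt F) \<dots>"
    by (intro diff_ideal_sum diff_ideal_frechet_adjoint diff_ideal_generator)
      (auto simp: adjoint_system_def)
  finally show ?thesis .
qed

text \<open>The extra terms of \<open>Y\<close> differentiate only in \<open>V\<close> and
  \<open>Vt\<close>, so the symmetry hypothesis on \<open>X\<close> can be used for
  \<open>Y\<close>.\<close>

lemma prolong_uv_vars_eq:
  assumes "\<And>z J. z \<notin> u_vars m mt \<Longrightarrow> pd (Jet z J) f = 0"
  shows "prolong n (uv_vars m mt) x y f = prolong n (u_vars m mt) x y f"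
  by (intro prolong_mono_neutral finite_uv_vars u_vars_subset_uv_vars) (use assms in auto)

lemma diff_ideal_prolong_equation:
  assumes F: "\<And>z J. z \<notin> u_vars m mt \<Longrightarrow> pd (Jet z J) (F \<nu>) = 0"
    and X: "prolong n (u_vars m mt) x y (F \<nu>) = (\<Sum>\<mu>=1..m. diff_op n (r \<mu>) (c \<mu>) (F \<mu>))"
  shows "diff_ideal n (adjoint_system n m mt F) (prolong n (uv_vars m mt) x y (F \<nu>))"
proof -
  have "prolong n (uv_vars m mt) x y (F \<nu>) = (\<Sum>\<mu>=1..m. diff_op n (r \<mu>) (c \<mu>) (F \<mu>))"
    unfolding X[symmetric] by (rule prolong_uv_vars_eq) (rule F)
  also have "diff_ideal n (adjoint_system n m mt F) \<dots>"
    unfolding diff_op_def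
    by (intro diff_ideal_sum diff_ideal.mult diff_ideal_td_list diff_ideal_generator)
      (auto simp: adjoint_system_def index_lists_def)
  finally show ?thesis .
qed

lemma euler_evol_lagrangian:
  assumes F: "\<And>\<nu> z J. \<nu> \<in> {1..m} \<Longrightarrow> z \<notin> u_vars m mt \<Longrightarrow> pd (Jet z J) (F \<nu>) = 0"
    and X: "\<And>\<nu>. \<nu> \<in> {1..m} \<Longrightarrow>
      prolong n (u_vars m mt) x y (F \<nu>) = (\<Sum>\<mu>=1..m. diff_op n (r \<nu> \<mu>) (c \<nu> \<mu>) (F \<mu>))"
    and eq: "\<And>\<beta>. \<beta> \<in> {1..m} \<Longrightarrow> y (V \<beta>) + (\<Sum>\<gamma>=1..mt. y (Vt \<gamma>)) =
      - (w_jet mt \<beta> * (\<Sum>i=1..n. td i (x i)) +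
         (\<Sum>\<mu>=1..m. adj_op n (r \<mu> \<beta>) (c \<mu> \<beta>) (w_jet mt \<mu>)))"
  shows "euler n z (evol n (uv_vars m mt) (lie_char n x y) (lagrangian m mt F)) = 0"
proof -
  let ?P = "prolong n (uv_vars m mt) x y"
  let ?w = "w_jet mt"
  let ?div = "\<Sum>i=1..n. td i (x i)"
  let ?L = "lagrangian m mt F"
  have w: "?P (?w \<beta>) = y (V \<beta>) + (\<Sum>\<gamma>=1..mt. y (Vt \<gamma>))" if "\<beta> \<in> {1..m}" for \<beta>
  proof -
    have "?P (jet_coord (Jet z zero_index)) = y z" if "z \<in> V ` {1..m} \<union> Vt ` {1..mt}" for z
      using that by (intro prolong_coord finite_uv_vars) (auto simp: uv_vars_def)
    with that show ?thesis
      by (simp add: w_jet_def prolong.add prolong.sum)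
  qed
  have PF: "?P (F \<nu>) = (\<Sum>\<mu>=1..m. diff_op n (r \<nu> \<mu>) (c \<nu> \<mu>) (F \<mu>))" if "\<nu> \<in> {1..m}" for \<nu>
    unfolding X[OF that, symmetric] by (rule prolong_uv_vars_eq) (rule F[OF that])
  have "?P ?L + ?div * ?L = (\<Sum>\<beta>=1..m. ?P (?w \<beta>) * F \<beta> + ?w \<beta> * ?P (F \<beta>) + ?div * (?w \<beta> * F \<beta>))"
    by (simp add: lagrangian_def prolong.sum prolong_mult sum.distrib sum_distrib_left)
  \<comment> \<open>By \<open>eq\<close>, \<open>?P (?w \<beta>)\<close> contributes
    \<open>- ?w \<beta> * ?div\<close>, which cancels the divergence term; its remainder supplies
    the adjoint operators.\<close>
  also have "\<dots> = (\<Sum>\<beta>=1..m. (\<Sum>\<mu>=1..m. ?w \<beta> * diff_op n (r \<beta> \<mu>) (c \<beta> \<mu>) (F \<mu>)) -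
      (\<Sum>\<mu>=1..m. adj_op n (r \<mu> \<beta>) (c \<mu> \<beta>) (?w \<mu>) * F \<beta>))"
  proof (intro sum.cong refl)
    fix \<beta> assume \<beta>: "\<beta> \<in> {1..m}"
    show "?P (?w \<beta>) * F \<beta> + ?w \<beta> * ?P (F \<beta>) + ?div * (?w \<beta> * F \<beta>) =
      (\<Sum>\<mu>=1..m. ?w \<beta> * diff_op n (r \<beta> \<mu>) (c \<beta> \<mu>) (F \<mu>)) -
      (\<Sum>\<mu>=1..m. adj_op n (r \<mu> \<beta>) (c \<mu> \<beta>) (?w \<mu>) * F \<beta>)"
      unfolding w[OF \<beta>] eq[OF \<beta>] PF[OF \<beta>] sum_distrib_left[symmetric] sum_distrib_right[symmetric]
      by (simp add: algebra_simps)
  qed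
  finally have "euler n z (?P ?L + ?div * ?L) =
      (\<Sum>\<beta>=1..m. \<Sum>\<mu>=1..m. euler n z (adj_op n (r \<beta> \<mu>) (c \<beta> \<mu>) (?w \<beta>) * F \<mu>)) -
      (\<Sum>\<beta>=1..m. \<Sum>\<mu>=1..m. euler n z (adj_op n (r \<mu> \<beta>) (c \<mu> \<beta>) (?w \<mu>) * F \<beta>))"
    by (simp add: euler.sum euler.diff sum_subtractf euler_diff_op)
  \<comment> \<open>The index pairs of the two double sums are transposed; exchanging the order of
    summation in one of them makes them equal.\<close>
  also have "\<dots> = 0"
    by (subst sum.swap) simp
  finally have "euler n z (?P ?L + ?div * ?L) = 0" .
  moreover have "?P ?L + ?div * ?L =
      evol n (uv_vars m mt) (lie_char n x y) ?L + (\<Sum>i=1..n. td i (x i * ?L))"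
    by (simp add: prolong_def td_mult sum.distrib sum_distrib_right)
  moreover have "euler n z (\<Sum>i=1..n. td i (x i * ?L)) = 0"
    by (simp add: euler.sum euler_td)
  ultimately show ?thesis by (metis euler.add add_0_right)
qed

text \<open>The left side of \<open>euler_evol\<close> vanishes for the Lagrangian, so
  \<open>evol\<close> of its Euler derivative is minus a sum of Frechet adjoints applied to Euler
  derivatives, which lie in the ideal. The transport part of the prolongation stays there because
  the ideal is closed under \<open>td\<close>.\<close>

lemma diff_ideal_prolong_adjoint:
  assumes F: "\<And>\<nu> z J. \<nu> \<in> {1..m} \<Longrightarrow> z \<notin> u_vars m mt \<Longrightarrow> pd (Jet z J) (F \<nu>) = 0"
    and X: "\<And>\<nu>. \<nu> \<in> {1..m} \<Longrightarrow>
      prolong n (u_vars m mt) x y (F \<nu>) = (\<Sum>\<mu>=1..m. diff_op n (r \<nu> \<mu>) (c \<nu> \<mu>) (F \<mu>))"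
    and eq: "\<And>\<beta>. \<beta> \<in> {1..m} \<Longrightarrow> y (V \<beta>) + (\<Sum>\<gamma>=1..mt. y (Vt \<gamma>)) =
      - (w_jet mt \<beta> * (\<Sum>i=1..n. td i (x i)) +
         (\<Sum>\<mu>=1..m. adj_op n (r \<mu> \<beta>) (c \<mu> \<beta>) (w_jet mt \<mu>)))"
  shows "diff_ideal n (adjoint_system n m mt F)
    (prolong n (uv_vars m mt) x y (euler n z (lagrangian m mt F)))"
proof -
  let ?W = "lie_char n x y"
  let ?L = "lagrangian m mt F"
  have "evol n (uv_vars m mt) ?W (euler n z ?L) =
      - (\<Sum>v\<in>uv_vars m mt. frechet_adjoint n z (?W v) (euler n v ?L))"
    using euler_evol[OF finite_uv_vars, of n z m mt ?W ?L] euler_evol_lagrangian[OF F X eq, of z]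
    by (simp add: eq_neg_iff_add_eq_0)
  moreover have "diff_ideal n (adjoint_system n m mt F) \<dots>"
    by (intro diff_ideal_uminus diff_ideal_sum diff_ideal_frechet_adjoint diff_ideal_euler_lagrangian F)
  moreover have "diff_ideal n (adjoint_system n m mt F) (\<Sum>i=1..n. x i * td i (euler n z ?L))"
    by (intro diff_ideal_sum diff_ideal.mult diff_ideal_td diff_ideal_euler_lagrangian F)
  ultimately show ?thesis
    unfolding prolong_def by (metis diff_ideal.add)
qed

section \<open>Passage between differential functions and ring elements\<close>

lemma diff_function_at_jet: "diff_function n Z f \<Longrightarrow> at_jet (Jet_fun f) = f"
  by (intro Jet_fun_inverse) (auto simp: diff_function_def cylindrical_def)

lemma pd_diff_function:
  assumes "diff_function n Z f" "z \<notin> Z"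
  shows "pd (Jet z J) (Jet_fun f) = 0"
proof (rule jet_fun_eqI)
  obtain C where C: "C \<subseteq> coords n Z" "\<And>p q. (\<forall>c\<in>C. p c = q c) \<Longrightarrow> f p = f q"
    using assms(1) unfolding diff_function_def by metis
  have "Jet z J \<notin> C"
    using C(1) assms(2) by (auto simp: coords_def)
  with C(2) have "jet_partial (Jet z J) f = (\<lambda>p. 0)"
    by (rule jet_partial_outside)
  then show "at_jet (pd (Jet z J) (Jet_fun f)) p = at_jet 0 p" for p
    by (simp add: at_jet_pd diff_function_at_jet[OF assms(1)])
qed

theorem theorem3p3:
  fixes n m mt :: nat
    and F :: "nat \<Rightarrow> jet \<Rightarrow> real"
    and \<xi> \<eta> \<eta>t \<eta>s \<eta>ts :: "nat \<Rightarrow> jet \<Rightarrow> real"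
    and r :: "nat \<Rightarrow> nat \<Rightarrow> nat"
    and lam :: "nat \<Rightarrow> nat \<Rightarrow> nat list \<Rightarrow> jet \<Rightarrow> real"
  assumes F: "\<And>\<alpha>. \<alpha> \<in> {1..m} \<Longrightarrow> diff_function n (u_vars m mt) (F \<alpha>)"
    and xi: "\<And>i. i \<in> {1..n} \<Longrightarrow> diff_function n (u_vars m mt) (\<xi> i)"
    and eta: "\<And>\<beta>. \<beta> \<in> {1..m} \<Longrightarrow> diff_function n (u_vars m mt) (\<eta> \<beta>)"
    and etat: "\<And>\<beta>. \<beta> \<in> {1..mt} \<Longrightarrow> diff_function n (u_vars m mt) (\<eta>t \<beta>)"
    and lam: "\<And>\<nu> \<mu> k is. \<nu> \<in> {1..m} \<Longrightarrow> \<mu> \<in> {1..m} \<Longrightarrow> k \<le> r \<nu> \<mu> \<Longrightarrow> is \<in> index_lists n k \<Longrightarrow>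
      diff_function n (u_vars m mt) (lam \<nu> \<mu> is)"
    and X: "\<And>\<nu> p. \<nu> \<in> {1..m} \<Longrightarrow>
      prolongation n (u_vars m mt) \<xi> (case_depvar \<eta> \<eta>t (\<lambda>_ _. 0) (\<lambda>_ _. 0)) (F \<nu>) p =
      (\<Sum>\<mu>=1..m. diff_operator n (r \<nu> \<mu>) (lam \<nu> \<mu>) (F \<mu>) p)"
    and etas: "\<And>\<beta>. \<beta> \<in> {1..m} \<Longrightarrow> diff_function n (uv_vars m mt) (\<eta>s \<beta>)"
    and etats: "\<And>\<beta>. \<beta> \<in> {1..mt} \<Longrightarrow> diff_function n (uv_vars m mt) (\<eta>ts \<beta>)"
    and eq: "\<And>\<beta> p. \<beta> \<in> {1..m} \<Longrightarrow>
      \<eta>s \<beta> p + (\<Sum>\<gamma>=1..mt. \<eta>ts \<gamma> p) =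
      - (w_fun mt \<beta> p * (\<Sum>i=1..n. total_deriv i (\<xi> i) p) +
         (\<Sum>\<mu>=1..m. adjoint_operator n (r \<mu> \<beta>) (lam \<mu> \<beta>) (w_fun mt \<mu>) p))"
  shows "admits n (uv_vars m mt)
    (adjoint_F n m mt F ` {1..m} \<union> adjoint_Ft n m mt F ` {1..mt} \<union> F ` {1..m})
    \<xi> (case_depvar \<eta> \<eta>t \<eta>s \<eta>ts)"
proof -
  define Fj where "Fj \<nu> = Jet_fun (F \<nu>)" for \<nu>
  define x where "x i = Jet_fun (\<xi> i)" for i
  define y where "y z = Jet_fun (case_depvar \<eta> \<eta>t \<eta>s \<eta>ts z)" for z
  define c where "c \<nu> \<mu> is = Jet_fun (lam \<nu> \<mu> is)" for \<nu> \<mu> "is"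
  let ?S = "adjoint_system n m mt Fj"
  have Fj: "at_jet (Fj \<nu>) = F \<nu>" if "\<nu> \<in> {1..m}" for \<nu>
    unfolding Fj_def by (rule diff_function_at_jet[OF F[OF that]])
  have x: "at_jet (x i) = \<xi> i" if "i \<in> {1..n}" for i
    unfolding x_def by (rule diff_function_at_jet[OF xi[OF that]])
  have y: "at_jet (y z) = case_depvar \<eta> \<eta>t \<eta>s \<eta>ts z" if "z \<in> uv_vars m mt" for z
    using that diff_function_at_jet[OF eta] diff_function_at_jet[OF etat]
      diff_function_at_jet[OF etas] diff_function_at_jet[OF etats]
    by (auto simp: uv_vars_def u_vars_def y_def)
  have c: "at_jet (c \<nu> \<mu> is) = lam \<nu> \<mu> is"
    if "\<nu> \<in> {1..m}" "\<mu> \<in> {1..m}" "k \<le> r \<nu> \<mu>" "is \<in> index_lists n k" for \<nu> \<mu> k "is"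
    unfolding c_def by (rule diff_function_at_jet[OF lam[OF that]])
  have indep: "pd (Jet z J) (Fj \<nu>) = 0" if "\<nu> \<in> {1..m}" "z \<notin> u_vars m mt" for \<nu> z J
    unfolding Fj_def by (rule pd_diff_function[OF F[OF that(1)] that(2)])
  have X': "prolong n (u_vars m mt) x y (Fj \<nu>) = (\<Sum>\<mu>=1..m. diff_op n (r \<nu> \<mu>) (c \<nu> \<mu>) (Fj \<mu>))"
    if \<nu>: "\<nu> \<in> {1..m}" for \<nu>
  proof (rule jet_fun_eqI)
    fix p
    \<comment> \<open>\<open>X\<close> is given zero coefficients at \<open>V\<close> and
      \<open>Vt\<close>, while \<open>y\<close> carries those of \<open>Y\<close>; on
      \<open>u_vars\<close> the two families coincide.\<close>
    have "at_jet (y z) = case_depvar \<eta> \<eta>t (\<lambda>_ _. 0) (\<lambda>_ _. 0) z" if "z \<in> u_vars m mt" for z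
      using that y[of z] by (auto simp: uv_vars_def u_vars_def)
    with x have "at_jet (prolong n (u_vars m mt) x y (Fj \<nu>)) p =
        prolongation n (u_vars m mt) \<xi> (case_depvar \<eta> \<eta>t (\<lambda>_ _. 0) (\<lambda>_ _. 0)) (at_jet (Fj \<nu>)) p"
      by (rule at_jet_prolong)
    also have "\<dots> = (\<Sum>\<mu>=1..m. diff_operator n (r \<nu> \<mu>) (lam \<nu> \<mu>) (F \<mu>) p)"
      unfolding Fj[OF \<nu>] by (rule X[OF \<nu>])
    also have "\<dots> = (\<Sum>\<mu>=1..m. at_jet (diff_op n (r \<nu> \<mu>) (c \<nu> \<mu>) (Fj \<mu>)) p)"
    proof (intro sum.cong refl)
      fix \<mu> assume \<mu>: "\<mu> \<in> {1..m}"
      show "diff_operator n (r \<nu> \<mu>) (lam \<nu> \<mu>) (F \<mu>) p = at_jet (diff_op n (r \<nu> \<mu>) (c \<nu> \<mu>) (Fj \<mu>)) p"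
        unfolding Fj[OF \<mu>, symmetric] by (rule at_jet_diff_op[symmetric]) (rule c[OF \<nu> \<mu>])
    qed
    finally show "at_jet (prolong n (u_vars m mt) x y (Fj \<nu>)) p =
        at_jet (\<Sum>\<mu>=1..m. diff_op n (r \<nu> \<mu>) (c \<nu> \<mu>) (Fj \<mu>)) p"
      by simp
  qed
  have eq': "y (V \<beta>) + (\<Sum>\<gamma>=1..mt. y (Vt \<gamma>)) =
      - (w_jet mt \<beta> * (\<Sum>i=1..n. td i (x i)) +
         (\<Sum>\<mu>=1..m. adj_op n (r \<mu> \<beta>) (c \<mu> \<beta>) (w_jet mt \<mu>)))"
    if \<beta>: "\<beta> \<in> {1..m}" for \<beta>
  proof (rule jet_fun_eqI)
    fix p
    have "at_jet (adj_op n (r \<mu> \<beta>) (c \<mu> \<beta>) (w_jet mt \<mu>)) p =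
        adjoint_operator n (r \<mu> \<beta>) (lam \<mu> \<beta>) (w_fun mt \<mu>) p" if "\<mu> \<in> {1..m}" for \<mu>
      unfolding at_jet_w_jet[symmetric] by (rule at_jet_adj_op) (rule c[OF that \<beta>])
    moreover have "at_jet (y (V \<beta>)) = \<eta>s \<beta>" "\<And>\<gamma>. \<gamma> \<in> {1..mt} \<Longrightarrow> at_jet (y (Vt \<gamma>)) = \<eta>ts \<gamma>"
      using \<beta> by (simp_all add: y uv_vars_def)
    ultimately show "at_jet (y (V \<beta>) + (\<Sum>\<gamma>=1..mt. y (Vt \<gamma>))) p =
      at_jet (- (w_jet mt \<beta> * (\<Sum>i=1..n. td i (x i)) +
         (\<Sum>\<mu>=1..m. adj_op n (r \<mu> \<beta>) (c \<mu> \<beta>) (w_jet mt \<mu>)))) p"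
      using eq[OF \<beta>, of p] by (simp add: at_jet_w_jet at_jet_td x)
  qed
  have "at_jet (lagrangian m mt Fj) = adjoint_lagrangian m mt F"
    by (rule at_jet_lagrangian) (rule Fj)
  then have S: "adjoint_F n m mt F ` {1..m} \<union> adjoint_Ft n m mt F ` {1..mt} \<union> F ` {1..m} = at_jet ` ?S"
    using Fj by (auto simp: adjoint_system_def adjoint_F_def adjoint_Ft_def at_jet_euler image_Un image_image)
  \<comment> \<open>\<open>diff_ideal_prolong_adjoint\<close> holds for every \<open>z\<close> and
    so covers both \<open>U\<close> and \<open>Ut\<close>; the members \<open>Fj \<nu>\<close> fall
    under \<open>diff_ideal_prolong_equation\<close>.\<close>
  have ideal: "diff_ideal n ?S (prolong n (uv_vars m mt) x y e)" if "e \<in> ?S" for e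
    using that diff_ideal_prolong_adjoint[OF indep X' eq'] diff_ideal_prolong_equation[OF indep X']
    unfolding adjoint_system_def by auto
  have "prolongation n (uv_vars m mt) \<xi> (case_depvar \<eta> \<eta>t \<eta>s \<eta>ts) (at_jet e) p = 0"
    if e: "e \<in> ?S" and p: "\<And>G J. G \<in> ?S \<Longrightarrow> total_deriv_index n J (at_jet G) p = 0" for e p
  proof -
    have "prolongation n (uv_vars m mt) \<xi> (case_depvar \<eta> \<eta>t \<eta>s \<eta>ts) (at_jet e) p =
        at_jet (prolong n (uv_vars m mt) x y e) p"
      by (rule at_jet_prolong[symmetric]) (simp_all add: x y)
    also have "\<dots> = 0"
      by (rule diff_ideal_vanishes[OF ideal[OF e]]) (simp add: at_jet_td_index p)
    finally show ?thesis .
  qed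
  then show ?thesis
    unfolding S admits_def by blast
qed

end
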